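(* Let $R>1$ and $\theta\in(-\pi/2,\pi/2)$ satisfy $1<R\cos\theta\le\frac32$. Then the Joukowski airfoil $K$ with parameters $R,\theta$ admits an electrostatic skeleton; that is, there is a positive measure $\mu$ with closed support $S\subset K$, where $S$ has empty interior and connected complement, such that the logarithmic potentials of $\mu$ and of the equilibrium measure $\mu_K$ of $K$ agree on $\mathbb C\setminus K$.
   Context: Let $J(\zeta)=\frac12(\zeta+1/\zeta)$ and, for $R>1$, $\theta\in(-\pi/2,\pi/2)$ with $R\cos\theta>1$, let $a=Re^{i\theta}$, $b=1-Re^{i\theta}$, $T(z)=az+b$ and $\Psi=J\circ T$. The map $\Psi$ is a conformal map of $\{|z|>1\}\cup\{\infty\}$ onto $\overline{\mathbb C}\setminus K$ with $\Psi(\infty)=\infty$, where $K$ is a compact set called the Joukowski airfoil with parameters $R,\theta$. The equilibrium measure $\mu_K$ is the usual potential-theoretic equilibrium (probability) measure of $K$, and the logarithmic potential of a measure $\nu$ is $z\mapsto\int\log\frac1{|z-t|}\,d\nu(t)$. *)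

theory Defs
  imports "HOL-Probability.Probability"
begin

definition joukowski :: "complex \<Rightarrow> complex" where
  "joukowski \<zeta> = (\<zeta> + 1 / \<zeta>) / 2"

definition airfoil_map :: "real \<Rightarrow> real \<Rightarrow> complex \<Rightarrow> complex" where
  "airfoil_map R \<theta> z =
     (let a = of_real R * exp (\<i> * of_real \<theta>); b = 1 - a in joukowski (a * z + b))"

(* airfoil_map R \<theta> fixes infinity, so the complement of its image in the sphere is the
   complement in the plane of the image of the finite exterior points. The argument of
   joukowski does not vanish there, since R cos \<theta> > 1 gives |b| < |a|. *)
definition joukowski_airfoil :: "real \<Rightarrow> real \<Rightarrow> complex set" where
  "joukowski_airfoil R \<theta> = - (airfoil_map R \<theta> ` {z. 1 < cmod z})"

(* Positive part minus negative part, so that a divergent integral is infinite instead of 0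
   as for the Bochner integral. The case of both parts being infinite does not arise for
   logarithmic kernels and finite measures of compact support. *)
definition ereal_integral :: "'a measure \<Rightarrow> ('a \<Rightarrow> ereal) \<Rightarrow> ereal" where
  "ereal_integral M f =
     enn2ereal (\<integral>\<^sup>+x. e2ennreal (f x) \<partial>M) - enn2ereal (\<integral>\<^sup>+x. e2ennreal (- f x) \<partial>M)"

definition log_kernel :: "complex \<Rightarrow> complex \<Rightarrow> ereal" where
  "log_kernel z t = (if z = t then \<infinity> else ereal (ln (1 / cmod (z - t))))"

definition log_potential :: "complex measure \<Rightarrow> complex \<Rightarrow> ereal" where
  "log_potential \<nu> z = ereal_integral \<nu> (\<lambda>t. log_kernel z t)"

definition log_energy :: "complex measure \<Rightarrow> ereal" where
  "log_energy \<nu> = ereal_integral \<nu> (log_potential \<nu>)"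

definition closed_support :: "'a::metric_space measure \<Rightarrow> 'a set" where
  "closed_support M = {x. \<forall>\<epsilon>>0. emeasure M (ball x \<epsilon>) > 0}"

definition borel_prob_measures_on :: "complex set \<Rightarrow> complex measure set" where
  "borel_prob_measures_on K =
     {\<nu>. sets \<nu> = sets borel \<and> prob_space \<nu> \<and> closed_support \<nu> \<subseteq> K}"

definition is_equilibrium_measure :: "complex set \<Rightarrow> complex measure \<Rightarrow> bool" where
  "is_equilibrium_measure K \<nu> \<longleftrightarrow>
     \<nu> \<in> borel_prob_measures_on K \<and>
     (\<forall>\<nu>'\<in>borel_prob_measures_on K. log_energy \<nu> \<le> log_energy \<nu>')"

(* Well defined for compact K of positive logarithmic capacity. *)
definition equilibrium_measure :: "complex set \<Rightarrow> complex measure" where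
  "equilibrium_measure K = (THE \<nu>. is_equilibrium_measure K \<nu>)"

definition is_electrostatic_skeleton :: "complex set \<Rightarrow> complex measure \<Rightarrow> bool" where
  "is_electrostatic_skeleton K \<mu> \<longleftrightarrow>
     sets \<mu> = sets borel \<and> finite_measure \<mu> \<and>
     closed_support \<mu> \<subseteq> K \<and>
     interior (closed_support \<mu>) = {} \<and>
     connected (- closed_support \<mu>) \<and>
     (\<forall>z\<in>-K. log_potential \<mu> z = log_potential (equilibrium_measure K) z)"

definition admits_electrostatic_skeleton :: "complex set \<Rightarrow> bool" where
  "admits_electrostatic_skeleton K \<longleftrightarrow> (\<exists>\<mu>. is_electrostatic_skeleton K \<mu>)"

end

theory Submission
  imports Defs "HOL-Complex_Analysis.Complex_Analysis"
begin

text \<open>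
Write \<open>a = R exp (i \<theta>)\<close>, \<open>b = 1 - a\<close> and \<open>J\<close> for the Joukowski map. The complement of the airfoil \<open>K\<close>
is the injective image under \<open>J\<close> of the exterior of the circle \<open>|z - b| = R\<close>. Both measures in the
theorem are written down explicitly as images of the uniform measure on \<open>[0,1]\<close>, and both potentials
are computed from one formula, Jensen's mean value \<open>circle_log_mean\<close>: the mean of
\<open>ln |A - B v|\<close> over the unit circle is \<open>ln (max |A| |B|)\<close>.

The equilibrium measure is the image of the uniform measure of the circle \<open>|z - b| = R\<close> under \<open>J\<close>.
Since \<open>J z - J w = (z - w) (w - 1/z) / (2 w)\<close>, its potential at \<open>J z\<close> is
\<open>ln 2 + ln R - ln (max R |z - b|) - ln (max R |1/z - b|)\<close> (\<open>log_potential_boundary\<close>), which is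
constant on \<open>K\<close>. A probability measure on \<open>K\<close> with constant potential is the unique minimiser
of the logarithmic energy (\<open>equilibrium_measure_eqI\<close>), because the logarithmic kernel is, up to a constant
term, an integral of Gaussian kernels (\<open>shifted_kernel_as_gaussians\<close>), and these are positive definite
because a Gaussian is the convolution of another Gaussian with itself (\<open>correlation_difference\<close>).

Up to a constant, the Green function of the complement of \<open>K\<close> at \<open>w\<close> is \<open>ln |z - b|\<close> for the
preimage \<open>z\<close> of \<open>w\<close> lying outside the circle. Its extension \<open>max (ln |z - b|) (ln |1/z - b|)\<close> is a subharmonic function of
\<open>w = J z\<close> on the whole plane, harmonic off the set where \<open>|z - b| = |1/z - b|\<close>, so the Riesz
measure of this extension is the skeleton. Put \<open>X = z - b\<close> and \<open>Y = 1/z - b\<close>. The identity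
\<open>4 (J z - \<gamma> t) (J z - \<gamma> (1 - t)) = (X - v Y) (X - Y / v)\<close> with \<open>v = exp (2 \<pi> i t)\<close> (\<open>skeleton_factor\<close>)
parametrises that set by an explicit curve \<open>\<gamma>\<close>, and together with \<open>circle_log_mean\<close> it shows that
the image of the uniform measure under \<open>\<gamma>\<close> has potential \<open>ln 2 - ln (max |X| |Y|)\<close>. Outside \<open>K\<close>
one has \<open>|Y| < R < |X|\<close> (\<open>inverse_exterior\<close>), so there the two potentials agree and \<open>\<gamma>\<close> lies in \<open>K\<close>.
The bound on \<open>R cos \<theta>\<close> keeps the square root in \<open>\<gamma>\<close> off its branch cut; then \<open>\<gamma>\<close> is an arc
(\<open>arc_skeleton\<close>), which has empty interior and does not separate the plane.
\<close>

section \<open>Logarithmic means over the unit circle\<close>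

definition unit_uniform :: "real measure" where
  "unit_uniform = restrict_space lborel {0..1}"

lemma space_unit_uniform: "space unit_uniform = {0..1}"
  by (simp add: unit_uniform_def space_restrict_space)

lemma prob_space_unit_uniform: "prob_space unit_uniform"
  by (rule prob_spaceI) (simp add: unit_uniform_def emeasure_restrict_space space_restrict_space)

interpretation unit: prob_space unit_uniform
  by (rule prob_space_unit_uniform)

lemma measurable_unit_uniform:
  "f \<in> borel_measurable borel \<Longrightarrow> f \<in> borel_measurable unit_uniform"
  unfolding unit_uniform_def by (intro measurable_restrict_space1) simp

lemma measurable_unit_uniform_continuous:
  "continuous_on {0..1} f \<Longrightarrow> f \<in> borel_measurable unit_uniform"
  unfolding unit_uniform_def
  using borel_measurable_continuous_on_restrict[of "{0..1}" f] by (simp add: measurable_def space_restrict_space sets_restrict_space)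

lemma has_bochner_integral_unit_uniform:
  fixes f :: "real \<Rightarrow> real"
  assumes "continuous_on {0..1} f" "(f has_integral I) {0..1}"
  shows "has_bochner_integral unit_uniform f I"
proof -
  have int: "set_integrable lborel {0..1} f"
    using borel_integrable_compact[OF _ assms(1)] by (simp add: set_integrable_def)
  then have "(LINT x:{0..1}|lborel. f x) = I"
    using set_borel_integral_eq_integral(2)[OF int] assms(2) by (simp add: integral_unique)
  with int show ?thesis
    by (simp add: has_bochner_integral_iff unit_uniform_def integrable_restrict_space
        integral_restrict_space set_integrable_def set_lebesgue_integral_def)
qed

lemma circle_mean_of_holomorphic:
  assumes "f holomorphic_on cball 0 1"
  shows "((\<lambda>t. f (cis (2 * pi * t))) has_integral f 0) {0..1}"
proof -
  define k where "k = 2 * of_real pi * \<i>"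
  have "((\<lambda>u. f u / (u - 0)) has_contour_integral (2 * of_real pi * \<i> * f 0)) (circlepath 0 1)"
    using assms by (intro Cauchy_integral_circlepath_simple) auto
  moreover have "circlepath 0 1 t = cis (2 * pi * t)" for t
    by (simp add: circlepath cis_conv_exp mult_ac)
  ultimately have "((\<lambda>t. f (cis (2 * pi * t)) * k) has_integral (f 0 * k)) {0..1}"
    unfolding has_contour_integral vector_derivative_circlepath k_def
    by (simp add: cis_conv_exp mult_ac)
  then have "((\<lambda>t. f (cis (2 * pi * t)) * k * inverse k) has_integral (f 0 * k * inverse k)) {0..1}"
    by (rule has_integral_mult_left)
  moreover have "k \<noteq> 0" by (simp add: k_def)
  ultimately show ?thesis by (simp add: mult.assoc)
qed

lemma circle_log_mean_inside:
  assumes "cmod c < 1"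
  shows "has_bochner_integral unit_uniform (\<lambda>t. ln (cmod (1 - c * cis (2 * pi * t)))) 0"
proof -
  have pos: "0 < Re (1 - c * z)" if "cmod z \<le> 1" for z
  proof -
    have "\<bar>Re (c * z)\<bar> \<le> cmod (c * z)" by (rule abs_Re_le_cmod)
    also have "\<dots> \<le> cmod c"
      using that by (simp add: norm_mult mult_left_le)
    finally show ?thesis using assms by simp
  qed
  then have nz: "1 - c * z \<noteq> 0" if "cmod z \<le> 1" for z
    using that by fastforce
  have "1 - c * z \<notin> \<real>\<^sub>\<le>\<^sub>0" if "cmod z \<le> 1" for z
    using pos[OF that] by (auto simp only: complex_nonpos_Reals_iff)
  then have "(\<lambda>z. Ln (1 - c * z)) holomorphic_on cball 0 1"
    by (intro holomorphic_intros) auto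
  from has_integral_Re[OF circle_mean_of_holomorphic[OF this]]
  have "((\<lambda>t. ln (cmod (1 - c * cis (2 * pi * t)))) has_integral 0) {0..1}"
    using nz by simp
  moreover have "continuous_on {0..1} (\<lambda>t. ln (cmod (1 - c * cis (2 * pi * t))))"
    using nz by (intro continuous_intros) auto
  ultimately show ?thesis by (intro has_bochner_integral_unit_uniform)
qed

lemma AE_circle_neq: "AE t in unit_uniform. cis (2 * pi * t) \<noteq> z"
proof -
  have "countable {t. cis (2 * pi * t) = z}"
  proof (cases "\<exists>s. cis (2 * pi * s) = z")
    case True
    then obtain s where s: "cis (2 * pi * s) = z" by blast
    have "{t. cis (2 * pi * t) = z} \<subseteq> range (\<lambda>n::int. s + of_int n)"
    proof
      fix t assume "t \<in> {t. cis (2 * pi * t) = z}"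
      then have "cis (2 * pi * t) = cis (2 * pi * s)" using s by simp
      then obtain n :: int where "2 * pi * t = 2 * pi * s + of_int (2 * n) * pi"
        using exp_eq[of "\<i> * of_real (2 * pi * t)" "\<i> * of_real (2 * pi * s)"]
        by (auto simp: cis_conv_exp complex_eq_iff)
      then have "2 * pi * t = 2 * pi * (s + of_int n)" by (simp add: algebra_simps)
      then have "t = s + of_int n" by simp
      then show "t \<in> range (\<lambda>n::int. s + of_int n)" by blast
    qed
    then show ?thesis by (rule countable_subset) auto
  qed auto
  then have "AE t in lborel. t \<notin> {t. cis (2 * pi * t) = z}"
    by (intro AE_not_in countable_imp_null_set_lborel)
  then show ?thesis
    unfolding unit_uniform_def by (subst AE_restrict_space_iff) auto
qed

text \<open>
The boundary case is the limit \<open>r \<rightarrow> 1\<close> of the means for \<open>r c\<close>. Fatou's lemma first shows that the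
limit function is integrable; it then dominates, because \<open>|1 - z| \<le> 2 |1 - r z|\<close> for \<open>|z| = 1\<close>.
\<close>

lemma circle_log_mean_on:
  assumes c: "cmod c = 1"
  shows "has_bochner_integral unit_uniform (\<lambda>t. ln (cmod (1 - c * cis (2 * pi * t)))) 0"
proof -
  define h where "h r t = ln (cmod (1 - of_real r * c * cis (2 * pi * t)))" for r t
  define r where "r n = 1 - 1 / real (n + 2)" for n
  have r: "0 \<le> r n" "r n < 1" for n by (auto simp: r_def field_simps)
  have rlim: "r \<longlonglongrightarrow> 1" unfolding r_def by real_asymp
  have mean: "has_bochner_integral unit_uniform (h (r n)) 0" for n
    unfolding h_def using r[of n] c by (intro circle_log_mean_inside) (simp add: norm_mult)
  have [measurable]: "h s \<in> borel_measurable unit_uniform" for s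
    unfolding h_def by (intro measurable_unit_uniform) (simp add: cis_conv_exp)
  have ne: "AE t in unit_uniform. 1 - c * cis (2 * pi * t) \<noteq> 0"
    using AE_circle_neq[of "1 / c"]
  proof eventually_elim
    case (elim t)
    have "c \<noteq> 0" using c by auto
    with elim show ?case by (simp add: eq_divide_eq mult.commute)
  qed
  have lim: "(\<lambda>n. h (r n) t) \<longlonglongrightarrow> h 1 t" if "1 - c * cis (2 * pi * t) \<noteq> 0" for t
    unfolding h_def using that
    by (intro tendsto_intros) (auto intro!: tendsto_eq_intros rlim tendsto_of_real)
  have compare: "h 1 t \<le> h (r n) t + ln 2" if "1 - c * cis (2 * pi * t) \<noteq> 0" for n t
  proof -
    let ?z = "c * cis (2 * pi * t)"
    have z: "cmod ?z = 1" using c by (simp add: norm_mult)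
    have "1 - r n \<le> cmod (1 - of_real (r n) * ?z)"
      using norm_triangle_ineq2[of 1 "of_real (r n) * ?z"] r[of n] z by (simp add: norm_mult)
    moreover have "cmod (1 - ?z) \<le> cmod (1 - of_real (r n) * ?z) + cmod (of_real (r n - 1) * ?z)"
      using norm_triangle_ineq[of "1 - of_real (r n) * ?z" "of_real (r n - 1) * ?z"]
      by (simp add: algebra_simps)
    moreover have "cmod (of_real (r n - 1) * ?z) = 1 - r n"
      using z r[of n] by (simp only: norm_mult norm_of_real) simp
    ultimately have "cmod (1 - ?z) \<le> cmod (1 - of_real (r n) * ?z) * 2" by linarith
    moreover have "0 < cmod (1 - ?z)" using that by simp
    ultimately have "ln (cmod (1 - ?z)) \<le> ln (cmod (1 - of_real (r n) * ?z) * 2)" 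
      by (intro ln_mono) auto
    also have "\<dots> = ln (cmod (1 - of_real (r n) * ?z)) + ln 2"
      using \<open>1 - r n \<le> _\<close> r[of n] by (intro ln_mult_pos) auto
    finally show ?thesis by (simp add: h_def mult.assoc)
  qed
  have upper: "h s t \<le> ln 2" if "0 \<le> s" "s \<le> 1" for s t
  proof (cases "1 - of_real s * c * cis (2 * pi * t) = 0")
    case False
    have "cmod (1 - of_real s * c * cis (2 * pi * t)) \<le> 1 + cmod (of_real s * c * cis (2 * pi * t))"
      using norm_triangle_ineq4[of 1 "of_real s * c * cis (2 * pi * t)"] by simp
    also have "\<dots> \<le> 2" using that c by (simp add: norm_mult)
    finally show ?thesis unfolding h_def using False by (intro ln_mono) auto
  qed (simp add: h_def)
  \<comment> \<open>Fatou applied to the nonnegative functions \<open>ln 2 - h (r n)\<close>, whose integrals all equal \<open>ln 2\<close>.\<close>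
  have "(\<integral>\<^sup>+t. ennreal (ln 2 - h 1 t) \<partial>unit_uniform)
      = (\<integral>\<^sup>+t. liminf (\<lambda>n. ennreal (ln 2 - h (r n) t)) \<partial>unit_uniform)"
    using ne
  proof (intro nn_integral_cong_AE, eventually_elim)
    case (elim t)
    then have "(\<lambda>n. ennreal (ln 2 - h (r n) t)) \<longlonglongrightarrow> ennreal (ln 2 - h 1 t)"
      by (intro tendsto_intros lim)
    then show ?case by (simp add: lim_imp_Liminf)
  qed
  also have "\<dots> \<le> liminf (\<lambda>n. \<integral>\<^sup>+t. ennreal (ln 2 - h (r n) t) \<partial>unit_uniform)"
    by (intro nn_integral_liminf) measurable
  also have "(\<lambda>n. \<integral>\<^sup>+t. ennreal (ln 2 - h (r n) t) \<partial>unit_uniform) = (\<lambda>n. ennreal (ln 2))"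
  proof
    fix n
    have "has_bochner_integral unit_uniform (\<lambda>t. ln 2 - h (r n) t) (ln 2 - 0)"
      using mean[of n] by (intro has_bochner_integral_diff)
        (auto simp: has_bochner_integral_iff unit.prob_space)
    then show "(\<integral>\<^sup>+t. ennreal (ln 2 - h (r n) t) \<partial>unit_uniform) = ennreal (ln 2)"
      using upper r[of n] by (subst nn_integral_eq_integral) (auto simp: has_bochner_integral_iff less_imp_le)
  qed
  finally have "(\<integral>\<^sup>+t. ennreal (ln 2 - h 1 t) \<partial>unit_uniform) < \<infinity>"
    by (simp add: Liminf_const order_le_less_trans)
  then have "integrable unit_uniform (\<lambda>t. ln 2 - h 1 t)"
    using upper[of 1] by (intro integrableI_nonneg) auto
  then have int: "integrable unit_uniform (\<lambda>t. 2 * ln 2 - h 1 t)"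
    using Bochner_Integration.integrable_add[of unit_uniform "\<lambda>_. ln 2" "\<lambda>t. ln 2 - h 1 t"] by simp
  have dom: "AE t in unit_uniform. norm (h (r n) t) \<le> 2 * ln 2 - h 1 t" for n
    using ne
  proof eventually_elim
    case (elim t)
    have "h (r n) t \<le> ln 2" "h 1 t \<le> ln 2" "h 1 t \<le> h (r n) t + ln 2" "0 < ln (2::real)"
      using upper r[of n] compare[OF elim] by (auto simp: less_imp_le)
    then show ?case unfolding real_norm_def abs_le_iff by linarith
  qed
  have limAE: "AE t in unit_uniform. (\<lambda>n. h (r n) t) \<longlonglongrightarrow> h 1 t"
    using ne by eventually_elim (rule lim)
  have "integrable unit_uniform (h 1)" "(\<lambda>n. integral\<^sup>L unit_uniform (h (r n))) \<longlonglongrightarrow> integral\<^sup>L unit_uniform (h 1)"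
    by (intro integrable_dominated_convergence[OF _ _ int limAE dom]
        integral_dominated_convergence[OF _ _ int limAE dom]; measurable)+
  moreover have "integral\<^sup>L unit_uniform (h (r n)) = 0" for n
    using mean[of n] by (simp add: has_bochner_integral_iff)
  ultimately show ?thesis
    by (simp add: has_bochner_integral_iff h_def[abs_def] LIMSEQ_const_iff)
qed

text \<open>
The case \<open>|B| > |A|\<close> reduces to the other one: conjugating \<open>A / v - B\<close>, where \<open>|v| = 1\<close>, exchanges
the roles of the two coefficients without a change of variables.
\<close>

lemma circle_log_mean:
  assumes "A \<noteq> 0 \<or> B \<noteq> 0"
  shows "has_bochner_integral unit_uniform (\<lambda>t. ln (cmod (A - B * cis (2 * pi * t))))
           (ln (max (cmod A) (cmod B)))"
proof -
  have main: "has_bochner_integral unit_uniform (\<lambda>t. ln (cmod (A - B * cis (2 * pi * t)))) (ln (cmod A))"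
    if "A \<noteq> 0" "cmod B \<le> cmod A" for A B
  proof -
    have "cmod (B / A) \<le> 1" using that by (simp add: norm_divide)
    then have "has_bochner_integral unit_uniform (\<lambda>t. ln (cmod (1 - B / A * cis (2 * pi * t)))) 0"
      using circle_log_mean_on[of "B / A"] circle_log_mean_inside[of "B / A"] by argo
    then have *: "has_bochner_integral unit_uniform
        (\<lambda>t. ln (cmod A) + ln (cmod (1 - B / A * cis (2 * pi * t)))) (ln (cmod A) + 0)"
      by (intro has_bochner_integral_add) (auto simp: has_bochner_integral_iff unit.prob_space)
    have "AE t in unit_uniform. 1 - B / A * cis (2 * pi * t) \<noteq> 0"
      using AE_circle_neq[of "A / B"] by eventually_elim (use that in \<open>auto simp: field_simps\<close>)
    then have "AE t in unit_uniform. ln (cmod A) + ln (cmod (1 - B / A * cis (2 * pi * t)))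
        = ln (cmod (A - B * cis (2 * pi * t)))"
    proof eventually_elim
      case (elim t)
      have "A - B * cis (2 * pi * t) = A * (1 - B / A * cis (2 * pi * t))"
        using that by (simp add: algebra_simps)
      then show ?case using elim that by (simp only: norm_mult) (simp add: ln_mult_pos)
    qed
    with * show ?thesis
      by (subst (asm) has_bochner_integral_cong_AE)
        (auto simp: cis_conv_exp intro!: measurable_unit_uniform)
  qed
  show ?thesis
  proof (cases "cmod B \<le> cmod A")
    case True
    then have "A \<noteq> 0" using assms by auto
    with True main[of A B] show ?thesis by (simp add: max_absorb1)
  next
    case False
    have "cmod (A - B * cis s) = cmod (cnj B - cnj A * cis s)" for s
    proof -
      have "A - B * cis s = cis s * (A * cnj (cis s) - B)"
        by (simp add: algebra_simps cis_cnj flip: cis_mult) (simp add: mult.assoc[symmetric] cis_mult)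
      then have "cmod (A - B * cis s) = cmod (A * cnj (cis s) - B)" by (simp add: norm_mult)
      also have "\<dots> = cmod (cnj (A * cnj (cis s) - B))" by (simp only: complex_mod_cnj)
      finally show ?thesis by (simp add: norm_minus_commute)
    qed
    moreover have "cnj B \<noteq> 0" using False by auto
    ultimately show ?thesis using False main[of "cnj B" "cnj A"] by (simp add: max_def)
  qed
qed

section \<open>Extended integrals, supports and the logarithmic energy\<close>

lemma ereal_integral_cong_AE:
  assumes "AE x in M. f x = g x"
  shows "ereal_integral M f = ereal_integral M g"
proof -
  have "(\<integral>\<^sup>+x. e2ennreal (f x) \<partial>M) = (\<integral>\<^sup>+x. e2ennreal (g x) \<partial>M)"
    "(\<integral>\<^sup>+x. e2ennreal (- f x) \<partial>M) = (\<integral>\<^sup>+x. e2ennreal (- g x) \<partial>M)"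
    using assms by (auto intro!: nn_integral_cong_AE elim: eventually_mono)
  then show ?thesis by (simp add: ereal_integral_def)
qed

lemma ereal_integral_ereal:
  assumes "integrable M f"
  shows "ereal_integral M (\<lambda>x. ereal (f x)) = ereal (integral\<^sup>L M f)"
proof -
  have "(\<integral>\<^sup>+x. ennreal (f x) \<partial>M) \<noteq> \<infinity>" "(\<integral>\<^sup>+x. ennreal (- f x) \<partial>M) \<noteq> \<infinity>"
    using assms unfolding real_integrable_def by auto
  then obtain p n where "0 \<le> p" "(\<integral>\<^sup>+x. ennreal (f x) \<partial>M) = ennreal p"
    "0 \<le> n" "(\<integral>\<^sup>+x. ennreal (- f x) \<partial>M) = ennreal n"
    by (metis ennreal_cases infinity_ennreal_def)
  then show ?thesis
    by (simp add: ereal_integral_def real_lebesgue_integral_def[OF assms])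
qed

text \<open>
Adding a constant to an integrand that is bounded below turns the difference of positive and negative
part into a single nonnegative integral, for which Tonelli's theorem is available.
\<close>

lemma ereal_integral_bounded_below:
  assumes "prob_space M" and [measurable]: "f \<in> borel_measurable M" and "0 \<le> c"
    and bound: "AE x in M. ereal (- c) \<le> f x"
  shows "ereal_integral M f = enn2ereal (\<integral>\<^sup>+x. e2ennreal (f x + ereal c) \<partial>M) - ereal c"
proof -
  interpret prob_space M by fact
  have *: "e2ennreal (y + ereal c) + e2ennreal (- y) = e2ennreal y + ennreal c \<and> e2ennreal (- y) \<le> ennreal c"
    if "ereal (- c) \<le> y" for y
  proof (cases y)
    case (real r)
    show ?thesis
    proof (cases "0 \<le> r")
      case True
      with real \<open>0 \<le> c\<close> show ?thesis by (simp add: ennreal_neg)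
    next
      case False
      then have "ennreal (r + c) + ennreal (- r) = ennreal c"
        using that real by (subst ennreal_plus[symmetric]) auto
      with False real that show ?thesis by (simp add: ennreal_neg ennreal_leI)
    qed
  qed (use that \<open>0 \<le> c\<close> in \<open>auto simp: e2ennreal_neg\<close>)
  let ?A = "\<integral>\<^sup>+x. e2ennreal (f x + ereal c) \<partial>M" and ?N = "\<integral>\<^sup>+x. e2ennreal (- f x) \<partial>M"
  let ?P = "\<integral>\<^sup>+x. e2ennreal (f x) \<partial>M"
  have "?A + ?N = (\<integral>\<^sup>+x. e2ennreal (f x + ereal c) + e2ennreal (- f x) \<partial>M)"
    by (intro nn_integral_add[symmetric]) measurable
  also have "\<dots> = (\<integral>\<^sup>+x. e2ennreal (f x) + ennreal c \<partial>M)"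
    using bound by (intro nn_integral_cong_AE) (use * in \<open>auto elim: eventually_mono\<close>)
  also have "\<dots> = ?P + ennreal c"
    by (subst nn_integral_add) (auto simp: emeasure_space_1)
  finally have sum: "?A + ?N = ?P + ennreal c" .
  have "?N \<le> (\<integral>\<^sup>+x. ennreal c \<partial>M)"
    using bound by (intro nn_integral_mono_AE) (use * in \<open>auto elim: eventually_mono\<close>)
  then have "?N \<le> ennreal c" by (simp add: emeasure_space_1)
  then obtain n where n: "0 \<le> n" "?N = ennreal n"
    by (metis ennreal_cases ennreal_neq_top top.extremum_unique)
  show ?thesis
  proof (cases ?A)
    case (real r)
    with sum n have "?P + ennreal c = ennreal (r + n)" by simp
    moreover then obtain p where p: "0 \<le> p" "?P = ennreal p" by (cases ?P) auto
    ultimately have "p + c = r + n"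
      using \<open>0 \<le> c\<close> n real by (simp flip: ennreal_plus)
    then show ?thesis using p n real by (simp add: ereal_integral_def)
  next
    case top
    with sum have "?P + ennreal c = top" by simp
    then have "?P = top" by (simp add: ennreal_add_eq_top)
    with top n show ?thesis by (simp add: ereal_integral_def)
  qed
qed

lemma AE_closed_support_subset:
  fixes M :: "complex measure"
  assumes "sets M = sets borel" "closed_support M \<subseteq> K" "closed K"
  shows "AE x in M. x \<in> K"
proof -
  define F where "F = {ball x \<epsilon> | x \<epsilon>. emeasure M (ball x \<epsilon>) = 0}"
  obtain F' where F': "F' \<subseteq> F" "countable F'" "\<Union>F' = \<Union>F"
    by (rule Lindelof[of F]) (auto simp: F_def)
  have "(\<Union>S\<in>F'. S) \<in> null_sets M"
    using F' assms(1) by (intro null_sets_UN') (auto simp: F_def null_sets_def)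
  moreover have "- K \<subseteq> \<Union>F"
  proof
    fix x assume "x \<in> - K"
    then obtain \<epsilon> where "\<epsilon> > 0" "emeasure M (ball x \<epsilon>) = 0"
      using assms(2) by (auto simp: closed_support_def zero_less_iff_neq_zero)
    then have "x \<in> ball x \<epsilon>" "ball x \<epsilon> \<in> F" by (auto simp: F_def)
    then show "x \<in> \<Union>F" by blast
  qed
  ultimately show ?thesis
    using F'(3) by (intro AE_I'[where N="\<Union>F'"]) auto
qed

lemma closed_support_subset:
  assumes "sets M = sets borel" "AE x in M. x \<in> K" "closed K"
  shows "closed_support M \<subseteq> K"
proof
  fix x assume x: "x \<in> closed_support M"
  show "x \<in> K"
  proof (rule ccontr)
    assume "x \<notin> K"
    then obtain \<epsilon> where \<epsilon>: "\<epsilon> > 0" "ball x \<epsilon> \<subseteq> - K"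
      using assms(3) by (metis ComplI open_Compl open_contains_ball)
    have "AE y in M. y \<notin> ball x \<epsilon>" using assms(2) by eventually_elim (use \<epsilon> in auto)
    then have "emeasure M (ball x \<epsilon>) = 0"
      using assms(1) by (subst (asm) AE_iff_null_sets[symmetric]) auto
    with x \<epsilon> show False by (auto simp: closed_support_def dest: spec[of _ \<epsilon>])
  qed
qed

text \<open>
The logarithmic kernel \<open>ln (D / |x - y|)\<close> rescaled to be nonnegative on sets of diameter at most \<open>D\<close>,
with value \<open>\<infinity>\<close> on the diagonal; \<^const>\<open>e2ennreal\<close> truncates it to \<open>0\<close> at larger distances.
\<close>

definition shifted_kernel :: "real \<Rightarrow> complex \<Rightarrow> complex \<Rightarrow> ennreal" where
  "shifted_kernel D x y = e2ennreal (log_kernel x y + ereal (ln D))"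

lemma shifted_kernel_eq:
  assumes "0 < D"
  shows "shifted_kernel D x y = (if x = y then top else ennreal (ln (D / cmod (x - y))))"
  using assms by (auto simp: shifted_kernel_def log_kernel_def ln_div)

lemma measurable_log_kernel [measurable]:
  "(\<lambda>p. log_kernel (fst p) (snd p)) \<in> borel_measurable (borel \<Otimes>\<^sub>M borel)"
  unfolding log_kernel_def by measurable

lemma measurable_log_kernel_right: "log_kernel x \<in> borel_measurable borel"
  unfolding log_kernel_def by measurable

lemma log_kernel_lower_bound:
  assumes "0 < D" "dist x y \<le> D"
  shows "ereal (- ln D) \<le> log_kernel x y"
  using assms by (auto simp: log_kernel_def ln_div dist_norm intro!: ln_mono)

text \<open>
The bound \<open>1 \<le> D\<close> makes the shift \<open>ln D\<close> nonnegative.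
\<close>

locale bounded_support =
  fixes K :: "complex set" and D :: real
  assumes closed_K: "closed K" and D: "1 \<le> D"
    and diameter: "\<And>x y. x \<in> K \<Longrightarrow> y \<in> K \<Longrightarrow> dist x y \<le> D"
begin

lemma AE_in_K:
  assumes "\<nu> \<in> borel_prob_measures_on K"
  shows "AE x in \<nu>. x \<in> K"
  using assms closed_K unfolding borel_prob_measures_on_def
  by (intro AE_closed_support_subset) auto

lemma log_potential_eq:
  assumes \<nu>: "\<nu> \<in> borel_prob_measures_on K" and x: "x \<in> K"
  shows "log_potential \<nu> x = enn2ereal (\<integral>\<^sup>+y. shifted_kernel D x y \<partial>\<nu>) - ereal (ln D)"
proof -
  have [measurable_cong]: "sets \<nu> = sets borel" and "prob_space \<nu>"
    using \<nu> by (auto simp: borel_prob_measures_on_def)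
  have "AE y in \<nu>. ereal (- ln D) \<le> log_kernel x y"
    using AE_in_K[OF \<nu>]
    by eventually_elim (use D diameter x in \<open>auto intro!: log_kernel_lower_bound\<close>)
  then show ?thesis
    unfolding log_potential_def shifted_kernel_def
    using D measurable_log_kernel_right[of x]
    by (intro ereal_integral_bounded_below \<open>prob_space \<nu>\<close>) (simp_all cong: measurable_cong_sets)
qed

definition energy :: "complex measure \<Rightarrow> complex measure \<Rightarrow> ennreal" where
  "energy \<mu> \<nu> = (\<integral>\<^sup>+x. \<integral>\<^sup>+y. shifted_kernel D x y \<partial>\<nu> \<partial>\<mu>)"

lemma log_energy_eq:
  assumes \<nu>: "\<nu> \<in> borel_prob_measures_on K"
  shows "log_energy \<nu> = enn2ereal (energy \<nu> \<nu>) - ereal (ln D)"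
proof -
  have [measurable_cong]: "sets \<nu> = sets borel" and "prob_space \<nu>"
    using \<nu> by (auto simp: borel_prob_measures_on_def)
  interpret prob_space \<nu> by fact
  let ?U = "\<lambda>x. \<integral>\<^sup>+y. shifted_kernel D x y \<partial>\<nu>"
  have [measurable]: "?U \<in> borel_measurable \<nu>"
    unfolding shifted_kernel_def by measurable
  have "log_energy \<nu> = ereal_integral \<nu> (\<lambda>x. enn2ereal (?U x) - ereal (ln D))"
    unfolding log_energy_def using AE_in_K[OF \<nu>]
    by (intro ereal_integral_cong_AE) (auto elim!: eventually_mono simp: log_potential_eq[OF \<nu>])
  moreover have "\<dots> = enn2ereal (\<integral>\<^sup>+x. e2ennreal (enn2ereal (?U x) - ereal (ln D) + ereal (ln D)) \<partial>\<nu>) - ereal (ln D)"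
  proof (intro ereal_integral_bounded_below \<open>prob_space \<nu>\<close> AE_I2)
    fix x
    show "ereal (- ln D) \<le> enn2ereal (?U x) - ereal (ln D)"
      by (cases "?U x") auto
  qed (use D in \<open>simp_all\<close>)
  moreover have "enn2ereal u - ereal (ln D) + ereal (ln D) = enn2ereal u" for u
    by (cases u) auto
  ultimately show ?thesis by (simp only: energy_def e2ennreal_enn2ereal)
qed

end

section \<open>The logarithmic kernel as an integral of Gaussians\<close>

lemma nn_integral_exp_decay:
  assumes "0 < (s::real)"
  shows "(\<integral>\<^sup>+t. ennreal (exp (- t * s)) * indicator {0<..} t \<partial>lborel) = ennreal (1 / s)"
proof -
  have "(\<integral>\<^sup>+t. ennreal (exp (- t * s)) * indicator {0<..} t \<partial>lborel)
      = (\<integral>\<^sup>+t. ennreal (exp (- t * s)) * indicator {0..} t \<partial>lborel)"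
    using AE_lborel_singleton[of 0]
    by (intro nn_integral_cong_AE) (auto elim!: eventually_mono split: split_indicator)
  also have "\<dots> = ennreal (0 - (- exp (- 0 * s) / s))"
  proof (rule nn_integral_FTC_atLeast)
    show "((\<lambda>t. - exp (- t * s) / s) \<longlongrightarrow> 0) at_top"
      using assms by real_asymp
  qed (use assms in \<open>auto intro!: derivative_eq_intros\<close>)
  finally show ?thesis by simp
qed

text \<open>
Writing \<open>(exp (- t p) - exp (- t q)) / t\<close> as the integral of \<open>exp (- t s)\<close> over \<open>s \<in> [p, q]\<close> and exchanging the order of
integration leaves the integral of \<open>1 / s\<close>.
\<close>

lemma frullani:
  assumes "0 < p" "p \<le> (q::real)"
  shows "(\<integral>\<^sup>+t. ennreal ((exp (- t * p) - exp (- t * q)) / t) * indicator {0<..} t \<partial>lborel)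
    = ennreal (ln (q / p))"
proof -
  have "(\<integral>\<^sup>+t. ennreal ((exp (- t * p) - exp (- t * q)) / t) * indicator {0<..} t \<partial>lborel)
      = (\<integral>\<^sup>+t. \<integral>\<^sup>+s. ennreal (exp (- t * s)) * indicator {0<..} t * indicator {p..q} s \<partial>lborel \<partial>lborel)"
  proof (intro nn_integral_cong)
    fix t :: real
    show "ennreal ((exp (- t * p) - exp (- t * q)) / t) * indicator {0<..} t
      = (\<integral>\<^sup>+s. ennreal (exp (- t * s)) * indicator {0<..} t * indicator {p..q} s \<partial>lborel)"
    proof (cases "0 < t")
      case True
      have "(\<integral>\<^sup>+s. ennreal (exp (- t * s)) * indicator {p..q} s \<partial>lborel)
          = ennreal (- exp (- t * q) / t - (- exp (- t * p) / t))"
        using True assms by (intro nn_integral_FTC_Icc) (auto intro!: derivative_eq_intros)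
      with True show ?thesis by (simp add: diff_divide_distrib)
    qed simp
  qed
  also have "\<dots> = (\<integral>\<^sup>+s. \<integral>\<^sup>+t. ennreal (exp (- t * s)) * indicator {0<..} t * indicator {p..q} s \<partial>lborel \<partial>lborel)"
    by (intro lborel_pair.Fubini') measurable
  also have "\<dots> = (\<integral>\<^sup>+s. ennreal (1 / s) * indicator {p..q} s \<partial>lborel)"
  proof (intro nn_integral_cong)
    fix s :: real
    show "(\<integral>\<^sup>+t. ennreal (exp (- t * s)) * indicator {0<..} t * indicator {p..q} s \<partial>lborel)
      = ennreal (1 / s) * indicator {p..q} s"
      using nn_integral_exp_decay[of s] assms by (auto simp: nn_integral_multc split: split_indicator)
  qed
  also have "\<dots> = ennreal (ln q - ln p)"
    using assms by (intro nn_integral_FTC_Icc) (auto intro!: derivative_eq_intros)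
  also have "ln q - ln p = ln (q / p)" using assms by (simp add: ln_div)
  finally show ?thesis .
qed

text \<open>
The diagonal value: by monotonicity the integral is at least \<open>ln (q / p)\<close> for every small \<open>p > 0\<close>.
\<close>

lemma frullani_0:
  assumes "0 < (q::real)"
  shows "(\<integral>\<^sup>+t. ennreal ((1 - exp (- t * q)) / t) * indicator {0<..} t \<partial>lborel) = top"
    (is "?I = _")
proof (rule ccontr)
  assume "?I \<noteq> top"
  then obtain r where r: "0 \<le> r" "?I = ennreal r" by (cases ?I) auto
  \<comment> \<open>chosen so that \<open>ln (q / p) = r + 1\<close> exceeds the assumed value \<open>r\<close>\<close>
  define p where "p = q * exp (- (r + 1))"
  have p: "0 < p" "p \<le> q"
    using assms r by (auto simp: p_def mult_left_le)
  have "ln (q / p) = r + 1"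
    using assms by (simp add: p_def ln_div ln_mult_pos)
  then have "ennreal (r + 1) = ennreal (ln (q / p))"
    by simp
  also have "\<dots> = (\<integral>\<^sup>+t. ennreal ((exp (- t * p) - exp (- t * q)) / t) * indicator {0<..} t \<partial>lborel)"
    using frullani[OF p] by simp
  also have "\<dots> \<le> ?I"
    using p by (intro nn_integral_mono) (auto intro!: ennreal_leI divide_right_mono split: split_indicator)
  finally show False using r by simp
qed

definition gaussian :: "real \<Rightarrow> complex \<Rightarrow> complex \<Rightarrow> real" where
  "gaussian t x y = exp (- t * (dist x y)\<^sup>2)"

lemma gaussian_nonneg [simp]: "0 \<le> gaussian t x y"
  by (simp add: gaussian_def)

lemma gaussian_le_1 [simp]: "0 \<le> t \<Longrightarrow> gaussian t x y \<le> 1"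
  by (simp add: gaussian_def)

lemma measurable_gaussian [measurable (raw)]:
  assumes [measurable]: "f \<in> borel_measurable M" "g \<in> borel_measurable M" "h \<in> borel_measurable M"
  shows "(\<lambda>w. gaussian (f w) (g w) (h w)) \<in> borel_measurable M"
  unfolding gaussian_def dist_norm by measurable

lemma nn_integral_shift:
  fixes f :: "complex \<Rightarrow> ennreal"
  assumes [measurable]: "f \<in> borel_measurable borel" and "c \<noteq> 0"
  shows "(\<integral>\<^sup>+s. f s \<partial>lborel) = ennreal (c\<^sup>2) * (\<integral>\<^sup>+u. f (x + c *\<^sub>R u) \<partial>lborel)"
proof -
  have [measurable]: "(\<lambda>u. x + c *\<^sub>R u) \<in> borel \<rightarrow>\<^sub>M borel" by measurable
  show ?thesis
    by (subst lborel_affine[OF assms(2), of x])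
      (simp add: nn_integral_density nn_integral_distr nn_integral_cmult)
qed

lemma nn_integral_unit_gaussian: "(\<integral>\<^sup>+u. gaussian 1 0 u \<partial>lborel) = ennreal pi"
proof -
  define I where "I = (\<integral>\<^sup>+r. ennreal (exp (- r\<^sup>2)) \<partial>(lborel::real measure))"
  have "(\<Prod>b\<in>Basis. ennreal (exp (- (u \<bullet> b)\<^sup>2))) = ennreal (gaussian 1 0 u)" for u
    by (simp add: gaussian_def Basis_complex_def complex_eq_iff cmod_power2 exp_add[symmetric]
        ennreal_mult[symmetric])
  moreover have "(\<integral>\<^sup>+u. (\<Prod>b\<in>Basis. ennreal (exp (- (u \<bullet> b)\<^sup>2))) \<partial>(lborel::complex measure))
      = (\<Prod>b\<in>(Basis::complex set). I)"
    unfolding I_def by (rule nn_integral_lborel_prod) auto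
  ultimately have "(\<integral>\<^sup>+u. gaussian 1 0 u \<partial>lborel) = I * I"
    by (simp add: power2_eq_square)
  moreover have "I = ennreal (sqrt pi)"
  proof -
    have "I = (\<integral>\<^sup>+r. ennreal (sqrt pi * normal_density 0 (1 / sqrt 2) r) \<partial>lborel)"
      by (simp add: I_def normal_density_def real_sqrt_mult power_divide)
    also have "\<dots> = ennreal (\<integral>r. sqrt pi * normal_density 0 (1 / sqrt 2) r \<partial>lborel)"
      by (intro nn_integral_eq_integral) auto
    finally show ?thesis by simp
  qed
  ultimately show ?thesis by (simp flip: ennreal_mult)
qed

lemma gaussian_scale: "c \<noteq> 0 \<Longrightarrow> gaussian t x (x + c *\<^sub>R u) = gaussian (t * c\<^sup>2) 0 u"
  by (simp add: gaussian_def dist_norm power_mult_distrib)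

text \<open>
The parallelogram law centred at the midpoint of \<open>x\<close> and \<open>y\<close>. Integrating over \<open>s\<close> exhibits a Gaussian
kernel as a convolution square, hence as a positive definite kernel.
\<close>

lemma gaussian_product:
  "gaussian (2 * t) x s * gaussian (2 * t) y s
    = gaussian t x y * gaussian (4 * t) ((1/2) *\<^sub>R (x + y)) s"
proof -
  have "2 * (dist x s)\<^sup>2 + 2 * (dist y s)\<^sup>2 = (dist x y)\<^sup>2 + 4 * (dist ((1/2) *\<^sub>R (x + y)) s)\<^sup>2"
    by (simp add: dist_norm cmod_power2) (simp add: power2_eq_square field_simps)
  then have "2 * t * (dist x s)\<^sup>2 + 2 * t * (dist y s)\<^sup>2
      = t * (dist x y)\<^sup>2 + 4 * t * (dist ((1/2) *\<^sub>R (x + y)) s)\<^sup>2"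
    by algebra
  then show ?thesis
    by (simp add: gaussian_def flip: exp_add)
qed

lemma nn_integral_gaussian:
  assumes "0 < t"
  shows "(\<integral>\<^sup>+s. gaussian t x s \<partial>lborel) = ennreal (pi / t)"
proof -
  have "(\<integral>\<^sup>+s. gaussian t x s \<partial>lborel)
      = ennreal ((1 / sqrt t)\<^sup>2) * (\<integral>\<^sup>+u. gaussian t x (x + (1 / sqrt t) *\<^sub>R u) \<partial>lborel)"
    using assms by (intro nn_integral_shift) auto
  also have "(\<lambda>u. gaussian t x (x + (1 / sqrt t) *\<^sub>R u)) = gaussian 1 0"
    using gaussian_scale[of "1 / sqrt t" t x] assms by (simp add: fun_eq_iff power_divide)
  also have "ennreal ((1 / sqrt t)\<^sup>2) * (\<integral>\<^sup>+u. gaussian 1 0 u \<partial>lborel) = ennreal (1 / t) * ennreal pi"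
    using assms by (simp add: power_divide nn_integral_unit_gaussian)
  finally show ?thesis using assms by (simp flip: ennreal_mult)
qed

text \<open>
Frullani's integral with \<open>p = |x - y|\<^sup>2\<close> and \<open>q = D\<^sup>2\<close>. The integrand is nonnegative when
\<open>|x - y| \<le> D\<close>, so no cancellation occurs when measures are integrated against it.
\<close>

lemma shifted_kernel_as_gaussians:
  assumes "0 < D" "dist x y \<le> D"
  shows "shifted_kernel D x y
    = (\<integral>\<^sup>+t. ennreal ((gaussian t x y - exp (- t * D\<^sup>2)) / (2 * t)) * indicator {0<..} t \<partial>lborel)"
proof -
  have "(\<integral>\<^sup>+t. ennreal ((gaussian t x y - exp (- t * D\<^sup>2)) / (2 * t)) * indicator {0<..} t \<partial>lborel)
      = (\<integral>\<^sup>+t. ennreal (1 / 2) * (ennreal ((gaussian t x y - exp (- t * D\<^sup>2)) / t) * indicator {0<..} t) \<partial>lborel)"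
  proof (intro nn_integral_cong)
    fix t :: real
    have "ennreal (1 / 2 * ((gaussian t x y - exp (- t * D\<^sup>2)) / t))
        = ennreal (1 / 2) * ennreal ((gaussian t x y - exp (- t * D\<^sup>2)) / t)"
      by (rule ennreal_mult') simp
    then show "ennreal ((gaussian t x y - exp (- t * D\<^sup>2)) / (2 * t)) * indicator {0<..} t
        = ennreal (1 / 2) * (ennreal ((gaussian t x y - exp (- t * D\<^sup>2)) / t) * indicator {0<..} t)"
      by (simp add: mult.assoc)
  qed
  also have "\<dots> = ennreal (1 / 2) * (\<integral>\<^sup>+t. ennreal ((gaussian t x y - exp (- t * D\<^sup>2)) / t) * indicator {0<..} t \<partial>lborel)"
    by (intro nn_integral_cmult) measurable
  also have "\<dots> = shifted_kernel D x y"
  proof (cases "x = y")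
    case True
    then have "gaussian t x y = 1" for t by (simp add: gaussian_def)
    moreover have "ennreal (1 / 2) * top = top"
      by (simp add: ennreal_mult_eq_top_iff)
    moreover have "shifted_kernel D x y = top"
      using True assms by (simp add: shifted_kernel_eq)
    ultimately show ?thesis
      using frullani_0[of "D\<^sup>2"] assms by (simp del: ennreal_half)
  next
    case False
    then have d: "0 < dist x y" by simp
    have "ln (D\<^sup>2 / (dist x y)\<^sup>2) = 2 * ln (D / dist x y)"
      using ln_realpow[of "D / dist x y" 2] d assms by (simp add: power_divide)
    moreover have "(dist x y)\<^sup>2 \<le> D\<^sup>2" using assms by (intro power_mono) auto
    ultimately have "(\<integral>\<^sup>+t. ennreal ((gaussian t x y - exp (- t * D\<^sup>2)) / t) * indicator {0<..} t \<partial>lborel)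
        = ennreal (2 * ln (D / dist x y))"
      using frullani[of "(dist x y)\<^sup>2" "D\<^sup>2"] d unfolding gaussian_def by simp
    moreover have "ennreal (1 / 2) * ennreal (2 * ln (D / dist x y)) = ennreal (ln (D / dist x y))"
      using d assms by (subst ennreal_mult[symmetric]) auto
    ultimately show ?thesis
      using False assms by (simp only: shifted_kernel_eq dist_norm) simp
  qed
  finally show ?thesis ..
qed

section \<open>Positive definiteness of the energy\<close>

definition correlation :: "real \<Rightarrow> complex measure \<Rightarrow> complex measure \<Rightarrow> real" where
  "correlation t \<mu> \<nu> = (\<integral>x. \<integral>y. gaussian t x y \<partial>\<nu> \<partial>\<mu>)"

definition smoothing :: "real \<Rightarrow> complex measure \<Rightarrow> complex \<Rightarrow> real" where
  "smoothing t \<nu> s = (\<integral>x. gaussian t x s \<partial>\<nu>)"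

locale borel_prob_pair = pair_prob_space \<mu> \<nu> for \<mu> \<nu> :: "complex measure" +
  assumes sets_fst [measurable_cong]: "sets \<mu> = sets borel"
    and sets_snd [measurable_cong]: "sets \<nu> = sets borel"
begin

lemma integrable_gaussian_fst: "0 \<le> t \<Longrightarrow> integrable \<mu> (\<lambda>x. gaussian t x s)"
  by (intro M1.integrable_const_bound[where B=1]) auto

lemma integrable_gaussian_snd:
  assumes "0 \<le> t"
  shows "integrable \<nu> (\<lambda>y. gaussian t x y)" "integrable \<nu> (\<lambda>y. gaussian t y x)"
  using assms by (auto intro!: M2.integrable_const_bound[where B=1])

lemma integral_gaussian_bounds:
  assumes "0 \<le> t"
  shows "0 \<le> (\<integral>y. gaussian t x y \<partial>\<nu>)" "(\<integral>y. gaussian t x y \<partial>\<nu>) \<le> 1"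
proof -
  show "0 \<le> (\<integral>y. gaussian t x y \<partial>\<nu>)" by simp
  have "(\<integral>y. gaussian t x y \<partial>\<nu>) \<le> (\<integral>y. 1 \<partial>\<nu>)"
    using assms by (intro integral_mono integrable_gaussian_snd) auto
  then show "(\<integral>y. gaussian t x y \<partial>\<nu>) \<le> 1" by (simp add: M2.prob_space)
qed

lemma integrable_integral_gaussian:
  "0 \<le> t \<Longrightarrow> integrable \<mu> (\<lambda>x. \<integral>y. gaussian t x y \<partial>\<nu>)"
  using integral_gaussian_bounds by (intro M1.integrable_const_bound[where B=1]) auto

lemma measurable_correlation: "(\<lambda>t. correlation t \<mu> \<nu>) \<in> borel_measurable borel"
  unfolding correlation_def by measurable

lemma nn_correlation:
  assumes "0 \<le> t"
  shows "(\<integral>\<^sup>+x. \<integral>\<^sup>+y. ennreal (gaussian t x y) \<partial>\<nu> \<partial>\<mu>) = ennreal (correlation t \<mu> \<nu>)"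
proof -
  have "(\<integral>\<^sup>+y. ennreal (gaussian t x y) \<partial>\<nu>) = ennreal (\<integral>y. gaussian t x y \<partial>\<nu>)" for x
    using assms by (intro nn_integral_eq_integral integrable_gaussian_snd) auto
  moreover have "(\<integral>\<^sup>+x. ennreal (\<integral>y. gaussian t x y \<partial>\<nu>) \<partial>\<mu>) = ennreal (correlation t \<mu> \<nu>)"
    unfolding correlation_def using assms integral_gaussian_bounds
    by (intro nn_integral_eq_integral integrable_integral_gaussian) auto
  ultimately show ?thesis by simp
qed

lemma nn_smoothing_snd:
  "0 \<le> t \<Longrightarrow> (\<integral>\<^sup>+y. ennreal (gaussian t y s) \<partial>\<nu>) = ennreal (smoothing t \<nu> s)"
  unfolding smoothing_def by (intro nn_integral_eq_integral integrable_gaussian_snd) auto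

lemma nn_smoothing_fst:
  "0 \<le> t \<Longrightarrow> (\<integral>\<^sup>+x. ennreal (gaussian t x s) \<partial>\<mu>) = ennreal (smoothing t \<mu> s)"
  unfolding smoothing_def by (intro nn_integral_eq_integral integrable_gaussian_fst) auto

lemma smoothing_nonneg: "0 \<le> smoothing t \<rho> s"
  by (simp add: smoothing_def)

lemma measurable_smoothing [measurable]:
  "smoothing t \<mu> \<in> borel_measurable borel" "smoothing t \<nu> \<in> borel_measurable borel"
  unfolding smoothing_def by measurable

lemma smoothing_inner_product:
  assumes t: "0 < t"
  shows "has_bochner_integral lborel (\<lambda>s. smoothing (2 * t) \<mu> s * smoothing (2 * t) \<nu> s)
    (pi / (4 * t) * correlation t \<mu> \<nu>)"
proof (rule has_bochner_integral_nn_integral)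
  have "(\<integral>\<^sup>+s. ennreal (smoothing (2 * t) \<mu> s * smoothing (2 * t) \<nu> s) \<partial>lborel)
      = (\<integral>\<^sup>+s. \<integral>\<^sup>+x. \<integral>\<^sup>+y. ennreal (gaussian (2 * t) x s * gaussian (2 * t) y s) \<partial>\<nu> \<partial>\<mu> \<partial>lborel)"
    using t by (simp add: ennreal_mult smoothing_nonneg nn_integral_cmult nn_integral_multc
        nn_smoothing_snd nn_smoothing_fst)
  also have "\<dots> = (\<integral>\<^sup>+x. \<integral>\<^sup>+s. \<integral>\<^sup>+y. ennreal (gaussian (2 * t) x s * gaussian (2 * t) y s) \<partial>\<nu> \<partial>lborel \<partial>\<mu>)"
    by (rule pair_sigma_finite.Fubini') (unfold_locales, measurable)
  also have "\<dots> = (\<integral>\<^sup>+x. \<integral>\<^sup>+y. \<integral>\<^sup>+s. ennreal (gaussian (2 * t) x s * gaussian (2 * t) y s) \<partial>lborel \<partial>\<nu> \<partial>\<mu>)"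
    by (intro nn_integral_cong pair_sigma_finite.Fubini') (unfold_locales, measurable)
  also have "\<dots> = (\<integral>\<^sup>+x. \<integral>\<^sup>+y. ennreal (gaussian t x y) * ennreal (pi / (4 * t)) \<partial>\<nu> \<partial>\<mu>)"
    using t by (simp add: gaussian_product ennreal_mult nn_integral_cmult nn_integral_gaussian)
  also have "\<dots> = ennreal (correlation t \<mu> \<nu>) * ennreal (pi / (4 * t))"
    using t by (simp add: nn_integral_multc nn_correlation)
  also have "\<dots> = ennreal (pi / (4 * t) * correlation t \<mu> \<nu>)"
    using t by (subst ennreal_mult'[symmetric]) (auto simp: mult.commute correlation_def)
  finally show "(\<integral>\<^sup>+s. ennreal (smoothing (2 * t) \<mu> s * smoothing (2 * t) \<nu> s) \<partial>lborel)
      = ennreal (pi / (4 * t) * correlation t \<mu> \<nu>)" .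
qed (use t in \<open>auto simp: smoothing_nonneg correlation_def\<close>)

end

text \<open>
Positive definiteness: the quadratic form of the Gaussian kernel at \<open>\<mu> - \<nu>\<close> is, up to a factor, the
squared \<open>L\<^sup>2\<close> norm of the difference of the smoothed measures.
\<close>

lemma correlation_difference:
  assumes "borel_prob_pair \<mu> \<mu>" "borel_prob_pair \<nu> \<nu>" "borel_prob_pair \<mu> \<nu>" and t: "0 < t"
  shows "has_bochner_integral lborel (\<lambda>s. (smoothing (2 * t) \<mu> s - smoothing (2 * t) \<nu> s)\<^sup>2)
    (pi / (4 * t) * (correlation t \<mu> \<mu> + correlation t \<nu> \<nu> - 2 * correlation t \<mu> \<nu>))"
proof -
  have "has_bochner_integral lborel
      (\<lambda>s. smoothing (2 * t) \<mu> s * smoothing (2 * t) \<mu> s + smoothing (2 * t) \<nu> s * smoothing (2 * t) \<nu> s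
        - 2 * (smoothing (2 * t) \<mu> s * smoothing (2 * t) \<nu> s))
      (pi / (4 * t) * correlation t \<mu> \<mu> + pi / (4 * t) * correlation t \<nu> \<nu>
        - 2 * (pi / (4 * t) * correlation t \<mu> \<nu>))"
    using assms(1-3)[THEN borel_prob_pair.smoothing_inner_product, OF t]
    by (intro has_bochner_integral_add has_bochner_integral_diff has_bochner_integral_mult_right)
  then show ?thesis by (simp add: power2_diff power2_eq_square algebra_simps)
qed

context bounded_support
begin

lemma borel_prob_pairI:
  assumes "\<mu> \<in> borel_prob_measures_on K" "\<nu> \<in> borel_prob_measures_on K"
  shows "borel_prob_pair \<mu> \<nu>"
proof -
  interpret M1: prob_space \<mu> using assms by (simp add: borel_prob_measures_on_def)
  interpret M2: prob_space \<nu> using assms by (simp add: borel_prob_measures_on_def)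
  show ?thesis
    using assms by unfold_locales (auto simp: borel_prob_measures_on_def)
qed

lemma gaussian_ge:
  assumes "x \<in> K" "y \<in> K" "0 \<le> t"
  shows "exp (- t * D\<^sup>2) \<le> gaussian t x y"
  using diameter[OF assms(1,2)] D assms(3)
  by (auto simp: gaussian_def intro!: mult_left_mono power_mono)

lemma correlation_ge:
  assumes \<mu>: "\<mu> \<in> borel_prob_measures_on K" and \<nu>: "\<nu> \<in> borel_prob_measures_on K" and t: "0 \<le> t"
  shows "AE x in \<mu>. exp (- t * D\<^sup>2) \<le> (\<integral>y. gaussian t x y \<partial>\<nu>)" "exp (- t * D\<^sup>2) \<le> correlation t \<mu> \<nu>"
proof -
  interpret borel_prob_pair \<mu> \<nu> using \<mu> \<nu> by (rule borel_prob_pairI)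
  show *: "AE x in \<mu>. exp (- t * D\<^sup>2) \<le> (\<integral>y. gaussian t x y \<partial>\<nu>)"
    using AE_in_K[OF \<mu>]
  proof eventually_elim
    case (elim x)
    have "AE y in \<nu>. exp (- t * D\<^sup>2) \<le> gaussian t x y"
      using AE_in_K[OF \<nu>] by eventually_elim (rule gaussian_ge[OF elim _ t])
    then have "(\<integral>y. exp (- t * D\<^sup>2) \<partial>\<nu>) \<le> (\<integral>y. gaussian t x y \<partial>\<nu>)"
      using t by (intro integral_mono_AE integrable_gaussian_snd) auto
    then show ?case by (simp add: M2.prob_space)
  qed
  have "(\<integral>x. exp (- t * D\<^sup>2) \<partial>\<mu>) \<le> correlation t \<mu> \<nu>"
    unfolding correlation_def using * t
    by (intro integral_mono_AE integrable_integral_gaussian) auto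
  then show "exp (- t * D\<^sup>2) \<le> correlation t \<mu> \<nu>" by (simp add: M1.prob_space)
qed

text \<open>
Tonelli's theorem moves the parameter \<open>t\<close> of \<open>shifted_kernel_as_gaussians\<close> outside.
\<close>

lemma energy_as_correlation:
  assumes \<mu>: "\<mu> \<in> borel_prob_measures_on K" and \<nu>: "\<nu> \<in> borel_prob_measures_on K"
  shows "energy \<mu> \<nu> = (\<integral>\<^sup>+t. ennreal ((correlation t \<mu> \<nu> - exp (- t * D\<^sup>2)) / (2 * t)) * indicator {0<..} t \<partial>lborel)"
proof -
  interpret borel_prob_pair \<mu> \<nu> using \<mu> \<nu> by (rule borel_prob_pairI)
  define h where "h t x y = ennreal ((gaussian t x y - exp (- t * D\<^sup>2)) / (2 * t)) * indicator {0<..} t" for t x y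
  have [measurable (raw)]: "(\<lambda>w. h (f w) (g w) (k w)) \<in> borel_measurable N"
    if [measurable]: "f \<in> borel_measurable N" "g \<in> borel_measurable N" "k \<in> borel_measurable N"
    for f g k and N :: "'z measure"
    unfolding h_def by measurable
  have "energy \<mu> \<nu> = (\<integral>\<^sup>+x. \<integral>\<^sup>+y. \<integral>\<^sup>+t. h t x y \<partial>lborel \<partial>\<nu> \<partial>\<mu>)"
    unfolding energy_def
  proof (rule nn_integral_cong_AE)
    show "AE x in \<mu>. (\<integral>\<^sup>+y. shifted_kernel D x y \<partial>\<nu>) = (\<integral>\<^sup>+y. \<integral>\<^sup>+t. h t x y \<partial>lborel \<partial>\<nu>)"
      using AE_in_K[OF \<mu>]
    proof eventually_elim
      case (elim x)
      have "AE y in \<nu>. shifted_kernel D x y = (\<integral>\<^sup>+t. h t x y \<partial>lborel)"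
        using AE_in_K[OF \<nu>] unfolding h_def
        by eventually_elim (use D elim in \<open>intro shifted_kernel_as_gaussians diameter; simp\<close>)
      then show ?case by (rule nn_integral_cong_AE)
    qed
  qed
  also have "\<dots> = (\<integral>\<^sup>+x. \<integral>\<^sup>+t. \<integral>\<^sup>+y. h t x y \<partial>\<nu> \<partial>lborel \<partial>\<mu>)"
    by (intro nn_integral_cong pair_sigma_finite.Fubini') (unfold_locales, measurable)
  also have "\<dots> = (\<integral>\<^sup>+t. \<integral>\<^sup>+x. \<integral>\<^sup>+y. h t x y \<partial>\<nu> \<partial>\<mu> \<partial>lborel)"
    by (rule pair_sigma_finite.Fubini') (unfold_locales, measurable)
  also have "\<dots> = (\<integral>\<^sup>+t. ennreal ((correlation t \<mu> \<nu> - exp (- t * D\<^sup>2)) / (2 * t)) * indicator {0<..} t \<partial>lborel)"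
  proof (rule nn_integral_cong)
    fix t :: real
    show "(\<integral>\<^sup>+x. \<integral>\<^sup>+y. h t x y \<partial>\<nu> \<partial>\<mu>) = ennreal ((correlation t \<mu> \<nu> - exp (- t * D\<^sup>2)) / (2 * t)) * indicator {0<..} t"
    proof (cases "0 < t")
      case True
      then have t: "0 \<le> t" by simp
      have "(\<integral>\<^sup>+y. h t x y \<partial>\<nu>) = ennreal (((\<integral>y. gaussian t x y \<partial>\<nu>) - exp (- t * D\<^sup>2)) / (2 * t))"
        if "x \<in> K" for x
      proof -
        have "(\<integral>\<^sup>+y. h t x y \<partial>\<nu>) = ennreal (\<integral>y. (gaussian t x y - exp (- t * D\<^sup>2)) / (2 * t) \<partial>\<nu>)"
        proof -
          have "AE y in \<nu>. 0 \<le> (gaussian t x y - exp (- t * D\<^sup>2)) / (2 * t)"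
            using AE_in_K[OF \<nu>]
            by eventually_elim (use t gaussian_ge[OF that _ t] in \<open>auto intro!: divide_nonneg_nonneg\<close>)
          then have "(\<integral>\<^sup>+y. ennreal ((gaussian t x y - exp (- t * D\<^sup>2)) / (2 * t)) \<partial>\<nu>)
              = ennreal (\<integral>y. (gaussian t x y - exp (- t * D\<^sup>2)) / (2 * t) \<partial>\<nu>)"
            using integrable_gaussian_snd(1)[OF t] by (intro nn_integral_eq_integral) auto
          then show ?thesis using True by (simp add: h_def)
        qed
        also have "(\<integral>y. (gaussian t x y - exp (- t * D\<^sup>2)) / (2 * t) \<partial>\<nu>)
            = ((\<integral>y. gaussian t x y \<partial>\<nu>) - exp (- t * D\<^sup>2)) / (2 * t)"
          using integrable_gaussian_snd(1)[OF t] by (simp add: M2.prob_space)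
        finally show ?thesis .
      qed
      then have "(\<integral>\<^sup>+x. \<integral>\<^sup>+y. h t x y \<partial>\<nu> \<partial>\<mu>)
          = (\<integral>\<^sup>+x. ennreal (((\<integral>y. gaussian t x y \<partial>\<nu>) - exp (- t * D\<^sup>2)) / (2 * t)) \<partial>\<mu>)"
        using AE_in_K[OF \<mu>] by (intro nn_integral_cong_AE) (auto elim: eventually_mono)
      also have "\<dots> = ennreal (\<integral>x. ((\<integral>y. gaussian t x y \<partial>\<nu>) - exp (- t * D\<^sup>2)) / (2 * t) \<partial>\<mu>)"
        using correlation_ge(1)[OF \<mu> \<nu> t] True integrable_integral_gaussian[OF t]
        by (intro nn_integral_eq_integral) (auto elim!: eventually_mono)
      also have "(\<integral>x. ((\<integral>y. gaussian t x y \<partial>\<nu>) - exp (- t * D\<^sup>2)) / (2 * t) \<partial>\<mu>)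
          = (correlation t \<mu> \<nu> - exp (- t * D\<^sup>2)) / (2 * t)"
        unfolding correlation_def
        using integrable_integral_gaussian[OF t] by (simp add: M1.prob_space)
      finally show ?thesis using True by simp
    qed (simp add: h_def)
  qed
  finally show ?thesis .
qed

definition discrepancy :: "real \<Rightarrow> complex measure \<Rightarrow> complex measure \<Rightarrow> real" where
  "discrepancy t \<mu> \<nu> = correlation t \<mu> \<mu> + correlation t \<nu> \<nu> - 2 * correlation t \<mu> \<nu>"

lemma discrepancy_nonneg:
  assumes "\<mu> \<in> borel_prob_measures_on K" "\<nu> \<in> borel_prob_measures_on K" "0 < t"
  shows "0 \<le> discrepancy t \<mu> \<nu>"
proof -
  have "0 \<le> pi / (4 * t) * discrepancy t \<mu> \<nu>"
    using correlation_difference[of \<mu> \<nu> t] assms borel_prob_pairI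
    unfolding discrepancy_def has_bochner_integral_iff
    by (metis (no_types, lifting) Bochner_Integration.integral_nonneg zero_le_power2)
  moreover have "0 < pi / (4 * t)" using assms(3) by simp
  ultimately show ?thesis by (simp only: zero_le_mult_iff) argo
qed

text \<open>
This says that the energy form at the neutral measure \<open>\<mu> - \<nu>\<close> is an integral of nonnegative
discrepancies; it is phrased as a sum because each of the three energies may be infinite.
\<close>

lemma energy_parallelogram:
  assumes \<mu>: "\<mu> \<in> borel_prob_measures_on K" and \<nu>: "\<nu> \<in> borel_prob_measures_on K"
  shows "energy \<mu> \<mu> + energy \<nu> \<nu> = 2 * energy \<mu> \<nu>
    + (\<integral>\<^sup>+t. ennreal (discrepancy t \<mu> \<nu> / (2 * t)) * indicator {0<..} t \<partial>lborel)"
proof -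
  note pair = borel_prob_pairI[OF \<mu> \<mu>] borel_prob_pairI[OF \<nu> \<nu>] borel_prob_pairI[OF \<mu> \<nu>]
  note [measurable] = pair[THEN borel_prob_pair.measurable_correlation]
  let ?e = "\<lambda>\<rho> \<sigma> t. ennreal ((correlation t \<rho> \<sigma> - exp (- t * D\<^sup>2)) / (2 * t)) * indicator {0<..} t"
  let ?d = "\<lambda>t. ennreal (discrepancy t \<mu> \<nu> / (2 * t)) * indicator {0<..} t"
  have [measurable]: "?d \<in> borel_measurable borel" unfolding discrepancy_def by measurable
  have "energy \<mu> \<mu> + energy \<nu> \<nu> = (\<integral>\<^sup>+t. ?e \<mu> \<mu> t + ?e \<nu> \<nu> t \<partial>lborel)"
    unfolding energy_as_correlation[OF \<mu> \<mu>] energy_as_correlation[OF \<nu> \<nu>]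
    by (intro nn_integral_add[symmetric]) measurable
  also have "\<dots> = (\<integral>\<^sup>+t. 2 * ?e \<mu> \<nu> t + ?d t \<partial>lborel)"
  proof (rule nn_integral_cong)
    fix t :: real
    show "?e \<mu> \<mu> t + ?e \<nu> \<nu> t = 2 * ?e \<mu> \<nu> t + ?d t"
    proof (cases "0 < t")
      case True
      then have t: "0 \<le> t" by simp
      define p where "p \<rho> \<sigma> = (correlation t \<rho> \<sigma> - exp (- t * D\<^sup>2)) / (2 * t)" for \<rho> \<sigma>
      have p: "0 \<le> p \<mu> \<mu>" "0 \<le> p \<nu> \<nu>" "0 \<le> p \<mu> \<nu>"
        using correlation_ge(2)[OF \<mu> \<mu> t] correlation_ge(2)[OF \<nu> \<nu> t] correlation_ge(2)[OF \<mu> \<nu> t] t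
        by (simp_all add: p_def)
      have "p \<mu> \<mu> + p \<nu> \<nu> = 2 * p \<mu> \<nu> + discrepancy t \<mu> \<nu> / (2 * t)"
        using True by (simp add: p_def discrepancy_def field_simps)
      moreover have "0 \<le> discrepancy t \<mu> \<nu> / (2 * t)"
        using discrepancy_nonneg[OF \<mu> \<nu> True] True by simp
      moreover have "ennreal (2 * p \<mu> \<nu>) = 2 * ennreal (p \<mu> \<nu>)"
        using p by (simp add: ennreal_mult)
      ultimately have "ennreal (p \<mu> \<mu>) + ennreal (p \<nu> \<nu>) = 2 * ennreal (p \<mu> \<nu>) + ennreal (discrepancy t \<mu> \<nu> / (2 * t))"
        using p by (metis ennreal_plus mult_nonneg_nonneg zero_le_numeral)
      then show ?thesis using True by (simp add: p_def)
    qed simp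
  qed
  also have "\<dots> = 2 * energy \<mu> \<nu> + (\<integral>\<^sup>+t. ?d t \<partial>lborel)"
    unfolding energy_as_correlation[OF \<mu> \<nu>]
    by (subst nn_integral_add) (auto simp: nn_integral_cmult)
  finally show ?thesis .
qed

end

section \<open>Uniqueness of the equilibrium measure\<close>

text \<open>
The indicator of a closed set \<open>C\<close> is the limit of \<open>max 0 (1 - n d(x, C))\<close>.
\<close>

lemma measure_eqI_continuous:
  fixes M N :: "'a::metric_space measure"
  assumes sets_M: "sets M = sets borel" and sets_N: "sets N = sets borel"
    and "prob_space M" "prob_space N"
    and eq: "\<And>f :: 'a \<Rightarrow> real. continuous_on UNIV f \<Longrightarrow> (\<And>x. 0 \<le> f x \<and> f x \<le> 1)
      \<Longrightarrow> (\<integral>\<^sup>+x. ennreal (f x) \<partial>M) = (\<integral>\<^sup>+x. ennreal (f x) \<partial>N)"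
  shows "M = N"
proof -
  have lim: "(\<lambda>n. \<integral>\<^sup>+x. ennreal (max 0 (1 - real n * infdist x C)) \<partial>L) \<longlonglongrightarrow> emeasure L C"
    if C: "closed C" "C \<noteq> {}" and sets_L: "sets L = sets borel" and "prob_space L" for C and L :: "'a measure"
  proof -
    interpret L: prob_space L by fact
    note [measurable_cong] = sets_L
    have [measurable]: "(\<lambda>x. infdist x C) \<in> borel_measurable borel"
      by (intro borel_measurable_continuous_onI continuous_intros)
    have [measurable]: "C \<in> sets borel" using C by simp
    have "(\<lambda>n. \<integral>\<^sup>+x. ennreal (max 0 (1 - real n * infdist x C)) \<partial>L) \<longlonglongrightarrow> (\<integral>\<^sup>+x. indicator C x \<partial>L)"
    proof (rule nn_integral_dominated_convergence[where w="\<lambda>_. 1"])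
      show "AE x in L. (\<lambda>n. ennreal (max 0 (1 - real n * infdist x C))) \<longlonglongrightarrow> indicator C x"
      proof (intro AE_I2)
        fix x
        show "(\<lambda>n. ennreal (max 0 (1 - real n * infdist x C))) \<longlonglongrightarrow> indicator C x"
        proof (cases "x \<in> C")
          case False
          then have pos: "0 < infdist x C"
            using C in_closed_iff_infdist_zero[of C x] infdist_nonneg[of x C] by fastforce
          obtain m where m: "1 < real m * infdist x C"
            using reals_Archimedean3[OF pos] by blast
          have "eventually (\<lambda>n. ennreal (max 0 (1 - real n * infdist x C)) = indicator C x) sequentially"
            using eventually_ge_at_top[of m]
          proof eventually_elim
            case (elim n)
            then have "real m * infdist x C \<le> real n * infdist x C"
              using pos by (intro mult_right_mono) auto
            with m False show ?case by simp
          qed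
          then show ?thesis by (rule tendsto_eventually)
        qed simp
      qed
    qed (auto simp: L.emeasure_space_1 infdist_nonneg intro!: AE_I2 ennreal_leI[of _ 1, simplified])
    then show ?thesis using sets_L C by simp
  qed
  have closed_eq: "emeasure M C = emeasure N C" if "closed C" for C
  proof (cases "C = {}")
    case False
    have "(\<integral>\<^sup>+x. ennreal (max 0 (1 - real n * infdist x C)) \<partial>M)
        = (\<integral>\<^sup>+x. ennreal (max 0 (1 - real n * infdist x C)) \<partial>N)" for n
    proof (rule eq)
      show "continuous_on UNIV (\<lambda>x. max 0 (1 - real n * infdist x C))"
        by (intro continuous_intros)
    qed (simp add: infdist_nonneg)
    with lim[OF that False sets_M assms(3)] lim[OF that False sets_N assms(4)]
    show ?thesis by (simp add: LIMSEQ_unique)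
  qed simp
  interpret N: prob_space N by fact
  show ?thesis
  proof (rule measure_eqI_generator_eq[where E="Collect closed" and \<Omega>=UNIV and A="\<lambda>_. UNIV"])
    show "Int_stable (Collect (closed :: 'a set \<Rightarrow> bool))" by (auto simp: Int_stable_def)
    show "sets M = sigma_sets UNIV (Collect closed)" "sets N = sigma_sets UNIV (Collect closed)"
      unfolding sets_M sets_N by (simp_all add: borel_eq_closed)
  qed (use N.emeasure_finite in \<open>auto simp: closed_eq\<close>)
qed

text \<open>
Substituting \<open>s = x + u / \<surd>\<tau>\<close> removes \<open>\<tau>\<close> from the Gaussian weight, so that the limit \<open>\<tau> \<rightarrow> \<infinity>\<close> in
\<open>smoothing_limit\<close> below is a case of dominated convergence.
\<close>

lemma smoothing_test_function:
  fixes f :: "complex \<Rightarrow> real"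
  assumes [measurable_cong]: "sets \<nu> = sets borel" and "prob_space \<nu>"
    and [measurable]: "f \<in> borel_measurable borel" and f: "\<And>x. 0 \<le> f x" and \<tau>: "0 < \<tau>"
  shows "ennreal \<tau> * (\<integral>\<^sup>+s. ennreal (f s * smoothing \<tau> \<nu> s) \<partial>lborel)
    = (\<integral>\<^sup>+x. \<integral>\<^sup>+u. ennreal (f (x + (1 / sqrt \<tau>) *\<^sub>R u) * gaussian 1 0 u) \<partial>lborel \<partial>\<nu>)"
proof -
  interpret \<nu>: prob_space \<nu> by fact
  have "ennreal (f s * smoothing \<tau> \<nu> s) = (\<integral>\<^sup>+x. ennreal (f s * gaussian \<tau> x s) \<partial>\<nu>)" for s
  proof -
    have "integrable \<nu> (\<lambda>x. gaussian \<tau> x s)"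
      using \<tau> by (intro \<nu>.integrable_const_bound[where B=1]) auto
    then have "(\<integral>\<^sup>+x. ennreal (f s * gaussian \<tau> x s) \<partial>\<nu>) = ennreal (\<integral>x. f s * gaussian \<tau> x s \<partial>\<nu>)"
      using f by (intro nn_integral_eq_integral) auto
    then show ?thesis by (simp add: smoothing_def)
  qed
  then have "(\<integral>\<^sup>+s. ennreal (f s * smoothing \<tau> \<nu> s) \<partial>lborel)
      = (\<integral>\<^sup>+s. \<integral>\<^sup>+x. ennreal (f s * gaussian \<tau> x s) \<partial>\<nu> \<partial>lborel)" by simp
  also have "\<dots> = (\<integral>\<^sup>+x. \<integral>\<^sup>+s. ennreal (f s * gaussian \<tau> x s) \<partial>lborel \<partial>\<nu>)"
    by (rule pair_sigma_finite.Fubini') (unfold_locales, measurable)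
  also have "\<dots> = (\<integral>\<^sup>+x. ennreal (1 / \<tau>) * (\<integral>\<^sup>+u. ennreal (f (x + (1 / sqrt \<tau>) *\<^sub>R u) * gaussian 1 0 u) \<partial>lborel) \<partial>\<nu>)"
  proof (rule nn_integral_cong)
    fix x
    have scale: "gaussian \<tau> x (x + (1 / sqrt \<tau>) *\<^sub>R u) = gaussian 1 0 u" for u
      using gaussian_scale[of "1 / sqrt \<tau>" \<tau> x] \<tau> by (simp add: power_divide)
    have "(\<integral>\<^sup>+s. ennreal (f s * gaussian \<tau> x s) \<partial>lborel) = ennreal ((1 / sqrt \<tau>)\<^sup>2)
        * (\<integral>\<^sup>+u. ennreal (f (x + (1 / sqrt \<tau>) *\<^sub>R u) * gaussian \<tau> x (x + (1 / sqrt \<tau>) *\<^sub>R u)) \<partial>lborel)"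
      using \<tau> by (intro nn_integral_shift) auto
    then show "(\<integral>\<^sup>+s. ennreal (f s * gaussian \<tau> x s) \<partial>lborel)
        = ennreal (1 / \<tau>) * (\<integral>\<^sup>+u. ennreal (f (x + (1 / sqrt \<tau>) *\<^sub>R u) * gaussian 1 0 u) \<partial>lborel)"
      using \<tau> unfolding scale by (simp add: power_divide)
  qed
  also have "\<dots> = ennreal (1 / \<tau>) * (\<integral>\<^sup>+x. \<integral>\<^sup>+u. ennreal (f (x + (1 / sqrt \<tau>) *\<^sub>R u) * gaussian 1 0 u) \<partial>lborel \<partial>\<nu>)"
    by (rule nn_integral_cmult) measurable
  finally have *: "(\<integral>\<^sup>+s. ennreal (f s * smoothing \<tau> \<nu> s) \<partial>lborel)
    = ennreal (1 / \<tau>) * (\<integral>\<^sup>+x. \<integral>\<^sup>+u. ennreal (f (x + (1 / sqrt \<tau>) *\<^sub>R u) * gaussian 1 0 u) \<partial>lborel \<partial>\<nu>)" .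
  have "ennreal \<tau> * ennreal (1 / \<tau>) = 1" using \<tau> by (simp flip: ennreal_mult)
  then show ?thesis unfolding * by (simp add: mult.assoc[symmetric])
qed

lemma smoothing_limit:
  fixes f :: "complex \<Rightarrow> real"
  assumes [measurable_cong]: "sets \<nu> = sets borel" and "prob_space \<nu>"
    and cont: "continuous_on UNIV f" and f: "\<And>x. 0 \<le> f x \<and> f x \<le> 1"
    and \<tau>: "\<And>n. 0 < \<tau> n" "filterlim \<tau> at_top sequentially"
  shows "(\<lambda>n. ennreal (\<tau> n) * (\<integral>\<^sup>+s. ennreal (f s * smoothing (\<tau> n) \<nu> s) \<partial>lborel))
    \<longlonglongrightarrow> (\<integral>\<^sup>+x. ennreal (f x) \<partial>\<nu>) * ennreal pi"
proof -
  interpret \<nu>: prob_space \<nu> by fact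
  have [measurable]: "f \<in> borel_measurable borel" by (rule borel_measurable_continuous_onI[OF cont])
  define r where "r n = 1 / sqrt (\<tau> n)" for n
  have "r \<longlonglongrightarrow> 0"
    unfolding r_def using \<tau>(2)
    by (intro tendsto_divide_0[OF tendsto_const] filterlim_at_top_imp_at_infinity
        filterlim_compose[OF sqrt_at_top])
  have conv: "(\<lambda>n. f (x + r n *\<^sub>R u)) \<longlonglongrightarrow> f x" for x u
  proof -
    have "(\<lambda>n. x + r n *\<^sub>R u) \<longlonglongrightarrow> x + 0 *\<^sub>R u"
      by (intro tendsto_intros \<open>r \<longlonglongrightarrow> 0\<close>)
    then show ?thesis
      using continuous_on_tendsto_compose[OF cont, of "\<lambda>n. x + r n *\<^sub>R u" x sequentially] by simp
  qed
  let ?I = "\<lambda>n x. \<integral>\<^sup>+u. ennreal (f (x + r n *\<^sub>R u) * gaussian 1 0 u) \<partial>lborel"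
  have bound: "?I n x \<le> ennreal pi" for n x
  proof -
    have "?I n x \<le> (\<integral>\<^sup>+u. ennreal (gaussian 1 0 u) \<partial>lborel)"
      using f by (intro nn_integral_mono ennreal_leI) (simp add: mult_left_le_one_le)
    then show ?thesis by (simp add: nn_integral_unit_gaussian)
  qed
  have inner: "(\<lambda>n. ?I n x) \<longlonglongrightarrow> ennreal (f x) * ennreal pi" for x
  proof -
    have "(\<lambda>n. ?I n x) \<longlonglongrightarrow> (\<integral>\<^sup>+u. ennreal (f x * gaussian 1 0 u) \<partial>lborel)"
    proof (rule nn_integral_dominated_convergence[where w="\<lambda>u. ennreal (gaussian 1 0 u)"])
      show "AE u in lborel. ennreal (f (x + r n *\<^sub>R u) * gaussian 1 0 u) \<le> ennreal (gaussian 1 0 u)" for n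
        using f by (intro AE_I2 ennreal_leI) (simp add: mult_left_le_one_le)
      show "AE u in lborel. (\<lambda>n. ennreal (f (x + r n *\<^sub>R u) * gaussian 1 0 u)) \<longlonglongrightarrow> ennreal (f x * gaussian 1 0 u)"
        by (intro AE_I2 tendsto_intros conv)
    qed (simp_all add: nn_integral_unit_gaussian)
    then show ?thesis
      using f by (simp add: ennreal_mult nn_integral_cmult nn_integral_unit_gaussian)
  qed
  have "(\<lambda>n. \<integral>\<^sup>+x. ?I n x \<partial>\<nu>) \<longlonglongrightarrow> (\<integral>\<^sup>+x. ennreal (f x) * ennreal pi \<partial>\<nu>)"
    by (rule nn_integral_dominated_convergence[where w="\<lambda>_. ennreal pi"])
      (auto simp: bound inner \<nu>.emeasure_space_1)
  moreover have "ennreal (\<tau> n) * (\<integral>\<^sup>+s. ennreal (f s * smoothing (\<tau> n) \<nu> s) \<partial>lborel) = (\<integral>\<^sup>+x. ?I n x \<partial>\<nu>)" for n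
    unfolding r_def using assms(1,2) \<tau>(1) f by (intro smoothing_test_function) auto
  ultimately show ?thesis by (simp add: nn_integral_multc)
qed

lemma smoothing_determines_measure:
  assumes sets: "sets \<mu> = sets borel" "sets \<nu> = sets borel" and prob: "prob_space \<mu>" "prob_space \<nu>"
    and \<tau>: "\<And>n. 0 < \<tau> n" "filterlim \<tau> at_top sequentially"
    and eq: "\<And>n. AE s in lborel. smoothing (\<tau> n) \<mu> s = smoothing (\<tau> n) \<nu> s"
  shows "\<mu> = \<nu>"
proof (rule measure_eqI_continuous[OF sets prob])
  fix f :: "complex \<Rightarrow> real"
  assume f: "continuous_on UNIV f" "\<And>x. 0 \<le> f x \<and> f x \<le> 1"
  have "(\<integral>\<^sup>+s. ennreal (f s * smoothing (\<tau> n) \<mu> s) \<partial>lborel)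
      = (\<integral>\<^sup>+s. ennreal (f s * smoothing (\<tau> n) \<nu> s) \<partial>lborel)" for n
    using eq[of n] by (intro nn_integral_cong_AE) (auto elim: eventually_mono)
  with smoothing_limit[OF sets(1) prob(1) f \<tau>] smoothing_limit[OF sets(2) prob(2) f \<tau>]
  have "(\<integral>\<^sup>+x. ennreal (f x) \<partial>\<mu>) * ennreal pi = (\<integral>\<^sup>+x. ennreal (f x) \<partial>\<nu>) * ennreal pi"
    by (simp add: LIMSEQ_unique)
  moreover have "x * ennreal pi * ennreal (1 / pi) = x" for x
    by (simp add: mult.assoc flip: ennreal_mult)
  ultimately show "(\<integral>\<^sup>+x. ennreal (f x) \<partial>\<mu>) = (\<integral>\<^sup>+x. ennreal (f x) \<partial>\<nu>)"
    by metis
qed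

context bounded_support
begin

text \<open>
The discrepancy vanishes for almost every \<open>t\<close> only, but this suffices to choose parameters tending
to infinity along which the smoothed measures coincide.
\<close>

lemma discrepancy_zero_imp_eq:
  assumes \<mu>: "\<mu> \<in> borel_prob_measures_on K" and \<nu>: "\<nu> \<in> borel_prob_measures_on K"
    and zero: "(\<integral>\<^sup>+t. ennreal (discrepancy t \<mu> \<nu> / (2 * t)) * indicator {0<..} t \<partial>lborel) = 0"
  shows "\<mu> = \<nu>"
proof -
  note pair = borel_prob_pairI[OF \<mu> \<mu>] borel_prob_pairI[OF \<nu> \<nu>] borel_prob_pairI[OF \<mu> \<nu>]
  note [measurable] = pair[THEN borel_prob_pair.measurable_correlation]
  have "(\<lambda>t. ennreal (discrepancy t \<mu> \<nu> / (2 * t)) * indicator {0<..} t) \<in> borel_measurable lborel"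
    unfolding discrepancy_def by measurable
  from zero nn_integral_0_iff_AE[OF this]
  have "AE t in lborel. ennreal (discrepancy t \<mu> \<nu> / (2 * t)) * indicator {0<..} t = 0" by blast
  then have AE: "AE t in lborel. 0 < t \<longrightarrow> discrepancy t \<mu> \<nu> = 0"
  proof eventually_elim
    case (elim t)
    then show ?case
      using discrepancy_nonneg[OF \<mu> \<nu>, of t] by (auto simp: ennreal_eq_0_iff divide_le_0_iff)
  qed
  have "\<exists>t. real n < t \<and> discrepancy t \<mu> \<nu> = 0" for n
  proof (rule ccontr)
    assume "\<not> (\<exists>t. real n < t \<and> discrepancy t \<mu> \<nu> = 0)"
    with AE have "AE t in lborel. t \<notin> {real n<..<real n + 1}"
      by (auto elim!: eventually_mono)
    then have "emeasure lborel {real n<..<real n + 1} = 0"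
      by (subst (asm) AE_iff_null_sets[symmetric]) auto
    then show False by simp
  qed
  then obtain t where t: "\<And>n. real n < t n" "\<And>n. discrepancy (t n) \<mu> \<nu> = 0" by metis
  then have t_pos: "0 < t n" for n by (meson le_less_trans of_nat_0_le_iff)
  show ?thesis
  proof (rule smoothing_determines_measure)
    show "filterlim (\<lambda>n. 2 * t n) at_top sequentially"
    proof (rule filterlim_at_top_mono[OF filterlim_real_sequentially], intro always_eventually allI)
      show "real n \<le> 2 * t n" for n using t(1)[of n] t_pos[of n] by linarith
    qed
    show "AE s in lborel. smoothing (2 * t n) \<mu> s = smoothing (2 * t n) \<nu> s" for n
    proof -
      have "integrable lborel (\<lambda>s. (smoothing (2 * t n) \<mu> s - smoothing (2 * t n) \<nu> s)\<^sup>2)"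
        "(\<integral>s. (smoothing (2 * t n) \<mu> s - smoothing (2 * t n) \<nu> s)\<^sup>2 \<partial>lborel) = 0"
        using correlation_difference[OF pair t_pos[of n]] t(2)[of n]
        by (auto simp: has_bochner_integral_iff discrepancy_def)
      then have "AE s in lborel. (smoothing (2 * t n) \<mu> s - smoothing (2 * t n) \<nu> s)\<^sup>2 = 0"
        by (subst integral_nonneg_eq_0_iff_AE[symmetric]) auto
      then show ?thesis by eventually_elim simp
    qed
  qed (use \<mu> \<nu> t_pos in \<open>auto simp: borel_prob_measures_on_def\<close>)
qed

text \<open>
If \<open>\<mu>\<close> has constant potential, its mutual energy with any probability measure \<open>\<nu>\<close> on \<open>K\<close> is the
same finite number, and \<open>energy_parallelogram\<close> says that the energy of \<open>\<nu>\<close> exceeds that of \<open>\<mu>\<close>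
exactly by the integrated discrepancy.
\<close>

lemma is_equilibrium_measure_iff:
  assumes \<mu>: "\<mu> \<in> borel_prob_measures_on K"
    and const: "\<And>z. z \<in> K \<Longrightarrow> log_potential \<mu> z = ereal V"
  shows "is_equilibrium_measure K \<nu> \<longleftrightarrow> \<nu> = \<mu>"
proof -
  have potential: "(\<integral>\<^sup>+y. shifted_kernel D z y \<partial>\<mu>) = ennreal (V + ln D)" if "z \<in> K" for z
    using const[OF that] log_potential_eq[OF \<mu> that]
    by (cases "\<integral>\<^sup>+y. shifted_kernel D z y \<partial>\<mu>") (auto simp: algebra_simps)
  have mixed: "energy \<nu> \<mu> = ennreal (V + ln D)" if "\<nu> \<in> borel_prob_measures_on K" for \<nu>
  proof -
    interpret prob_space \<nu> using that by (simp add: borel_prob_measures_on_def)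
    have "energy \<nu> \<mu> = (\<integral>\<^sup>+x. ennreal (V + ln D) \<partial>\<nu>)"
      unfolding energy_def using AE_in_K[OF that]
      by (intro nn_integral_cong_AE) (auto elim!: eventually_mono simp: potential)
    then show ?thesis by (simp add: emeasure_space_1)
  qed
  have excess: "energy \<nu> \<nu> = energy \<mu> \<mu>
      + (\<integral>\<^sup>+t. ennreal (discrepancy t \<nu> \<mu> / (2 * t)) * indicator {0<..} t \<partial>lborel)" (is "_ = _ + ?d")
    if "\<nu> \<in> borel_prob_measures_on K" for \<nu>
  proof -
    have "ennreal (V + ln D) + energy \<nu> \<nu> = ennreal (V + ln D) + (ennreal (V + ln D) + ?d)"
      using energy_parallelogram[OF that \<mu>] mixed[OF that] mixed[OF \<mu>]
      by (simp add: mult_2 ac_simps)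
    then show ?thesis by (simp add: mixed[OF \<mu>] ennreal_add_left_cancel)
  qed
  have minimal: "log_energy \<mu> \<le> log_energy \<nu>" if "\<nu> \<in> borel_prob_measures_on K" for \<nu>
    unfolding log_energy_eq[OF \<mu>] log_energy_eq[OF that] excess[OF that]
    by (intro ereal_minus_mono) (auto simp: less_eq_ennreal.rep_eq[symmetric])
  show ?thesis
  proof
    assume "is_equilibrium_measure K \<nu>"
    then have \<nu>: "\<nu> \<in> borel_prob_measures_on K" and le: "log_energy \<nu> \<le> log_energy \<mu>"
      using \<mu> by (auto simp: is_equilibrium_measure_def)
    let ?d = "\<integral>\<^sup>+t. ennreal (discrepancy t \<nu> \<mu> / (2 * t)) * indicator {0<..} t \<partial>lborel"
    have "enn2ereal (energy \<nu> \<nu>) \<le> enn2ereal (energy \<mu> \<mu>)"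
      using le unfolding log_energy_eq[OF \<mu>] log_energy_eq[OF \<nu>]
      by (cases "enn2ereal (energy \<nu> \<nu>)"; cases "enn2ereal (energy \<mu> \<mu>)") auto
    then have "ennreal (V + ln D) + ?d \<le> ennreal (V + ln D) + 0"
      unfolding less_eq_ennreal.rep_eq[symmetric] excess[OF \<nu>] mixed[OF \<mu>] by simp
    then have "?d = 0"
      by (subst (asm) ennreal_add_left_cancel_le) auto
    then show "\<nu> = \<mu>" by (rule discrepancy_zero_imp_eq[OF \<nu> \<mu>])
  next
    assume "\<nu> = \<mu>"
    then show "is_equilibrium_measure K \<nu>"
      using \<mu> minimal by (simp add: is_equilibrium_measure_def)
  qed
qed

end

lemma equilibrium_measure_eqI:
  assumes "closed K" "bounded K" "\<mu> \<in> borel_prob_measures_on K"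
    and "\<And>z. z \<in> K \<Longrightarrow> log_potential \<mu> z = ereal V"
  shows "equilibrium_measure K = \<mu>"
proof -
  obtain B where B: "\<And>x. x \<in> K \<Longrightarrow> norm x \<le> B"
    using assms(2) by (auto simp: bounded_iff)
  interpret bounded_support K "max 1 (2 * B)"
  proof
    fix x y assume "x \<in> K" "y \<in> K"
    then show "dist x y \<le> max 1 (2 * B)"
      using norm_triangle_ineq4[of x y] B[of x] B[of y] by (auto simp: dist_norm)
  qed (use assms in auto)
  have "is_equilibrium_measure K = (\<lambda>\<nu>. \<nu> = \<mu>)"
    using is_equilibrium_measure_iff[OF assms(3,4)] by (intro ext) auto
  then show ?thesis
    unfolding equilibrium_measure_def by simp
qed

section \<open>Images of the uniform measure\<close>

lemma log_potential_distr_unit: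
  assumes [measurable]: "g \<in> borel_measurable unit_uniform"
    and int: "has_bochner_integral unit_uniform (\<lambda>t. ln (cmod (w - g t))) I"
    and ne: "AE t in unit_uniform. g t \<noteq> w"
  shows "log_potential (distr unit_uniform borel g) w = ereal (- I)"
proof -
  let ?M = "distr unit_uniform borel g"
  have "AE x in ?M. x \<noteq> w"
    using ne by (subst AE_distr_iff) auto
  then have "log_potential ?M w = ereal_integral ?M (\<lambda>x. ereal (- ln (cmod (w - x))))"
    unfolding log_potential_def
    by (intro ereal_integral_cong_AE) (auto elim!: eventually_mono simp: log_kernel_def ln_div)
  also have "\<dots> = ereal (\<integral>x. - ln (cmod (w - x)) \<partial>?M)"
    using int by (intro ereal_integral_ereal) (simp add: integrable_distr_eq has_bochner_integral_iff)
  also have "(\<integral>x. - ln (cmod (w - x)) \<partial>?M) = - I"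
    using int by (simp add: integral_distr has_bochner_integral_iff)
  finally show ?thesis .
qed

lemma closed_support_distr_unit:
  assumes "g \<in> borel_measurable unit_uniform" "g ` {0..1} \<subseteq> C" "closed C"
  shows "closed_support (distr unit_uniform borel g) \<subseteq> C"
  using assms by (intro closed_support_subset)
    (auto simp: AE_distr_iff space_unit_uniform intro!: AE_I2)

text \<open>
Invariance of dimension: the inverse of the arc would embed an open set into the line.
\<close>

lemma interior_arc_image:
  fixes \<gamma> :: "real \<Rightarrow> 'a::euclidean_space"
  assumes "arc \<gamma>" "2 \<le> DIM('a)"
  shows "interior (path_image \<gamma>) = {}"
proof (rule ccontr)
  assume ne: "interior (path_image \<gamma>) \<noteq> {}"
  obtain h where h: "homeomorphism {0..1} (path_image \<gamma>) \<gamma> h"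
    using homeomorphism_arc[OF assms(1)] .
  have "continuous_on (interior (path_image \<gamma>)) h" "inj_on h (interior (path_image \<gamma>))"
    using h interior_subset unfolding homeomorphism_def
    by (meson continuous_on_subset, metis inj_on_inverseI inj_on_subset)
  from invariance_of_dimension[OF this(1) open_interior this(2) ne] assms(2) show False by simp
qed

section \<open>Geometry of the airfoil\<close>

lemma joukowski_inverse: "joukowski (1 / z) = joukowski z"
  by (simp add: joukowski_def add.commute)

lemma joukowski_diff:
  assumes "z \<noteq> 0" "w \<noteq> 0"
  shows "joukowski z - joukowski w = (z - w) * (w - 1 / z) / (2 * w)"
  using assms by (simp add: joukowski_def field_simps)

lemma norm_joukowski_diff:
  assumes "z \<noteq> 0" "w \<noteq> 0"
  shows "cmod (joukowski z - joukowski w) = cmod (z - w) * cmod (1 / z - w) / (2 * cmod w)"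
  unfolding joukowski_diff[OF assms] by (simp add: norm_divide norm_mult norm_minus_commute)

lemma joukowski_eq_iff:
  assumes "z \<noteq> 0" "w \<noteq> 0"
  shows "joukowski z = joukowski w \<longleftrightarrow> w = z \<or> w = 1 / z"
proof -
  have "joukowski z = joukowski w \<longleftrightarrow> joukowski z - joukowski w = 0" by simp
  also have "\<dots> \<longleftrightarrow> w = z \<or> w = 1 / z"
    unfolding joukowski_diff[OF assms] using assms by auto
  finally show ?thesis .
qed

lemma joukowski_surj:
  obtains z where "z \<noteq> 0" "joukowski z = w"
proof
  define s where "s = csqrt (w\<^sup>2 - 1)"
  have s: "s\<^sup>2 = w\<^sup>2 - 1" by (simp add: s_def)
  then have 1: "(w + s) * (w - s) = 1" by (simp add: power2_eq_square algebra_simps)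
  then show ne: "w + s \<noteq> 0" by auto
  with 1 have "1 / (w + s) = w - s" by (simp add: field_simps)
  then show "joukowski (w + s) = w" by (simp add: joukowski_def)
qed

locale airfoil =
  fixes a b :: complex and R :: real
  assumes center: "a + b = 1" and radius: "R = cmod a" and Re_a: "1 < Re a"
begin

definition exterior :: "complex set" where
  "exterior = {z. R < cmod (z - b)}"

definition K :: "complex set" where
  "K = - (joukowski ` exterior)"

lemma R_pos: "0 < R"
  using Re_a complex_Re_le_cmod[of a] unfolding radius by linarith

lemma a_nonzero: "a \<noteq> 0"
  using Re_a by auto

lemma norm_b: "cmod b < R"
proof -
  have "b = 1 - a" using center by (simp add: algebra_simps)
  then have "(cmod b)\<^sup>2 < R\<^sup>2"
    using Re_a by (simp add: radius cmod_power2) (simp add: power2_eq_square algebra_simps)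
  then show ?thesis using R_pos by (simp add: power2_less_imp_less)
qed

lemma exterior_nonzero: "z \<in> exterior \<Longrightarrow> z \<noteq> 0"
  using norm_b by (auto simp: exterior_def)

text \<open>
Both the circle and its image under inversion pass through \<open>1\<close>, where they are tangent, and \<open>Re a > 1\<close>
puts \<open>-1\<close> inside the circle; hence inversion maps the exterior into the interior. With \<open>u = z - 1\<close> the
claim becomes \<open>|u|\<^sup>2 < 2 Re (u a') + 2 (Re a) |u|\<^sup>2\<close>, where \<open>a'\<close> is the conjugate of \<open>a\<close>, while
\<open>z\<close> being exterior means \<open>0 < |u|\<^sup>2 + 2 Re (u a')\<close>.
\<close>

lemma inverse_exterior:
  assumes "z \<in> exterior"
  shows "cmod (1 / z - b) < R"
proof -
  define u where "u = z - 1"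
  have z: "z \<noteq> 0" using assms by (rule exterior_nonzero)
  have b: "b = 1 - a" using center by (simp add: algebra_simps)
  have "z - b = u + a" by (simp add: u_def b)
  then have "R\<^sup>2 < (cmod (u + a))\<^sup>2"
    using assms R_pos by (intro power_strict_mono) (auto simp: exterior_def)
  then have ext: "0 < (cmod u)\<^sup>2 + 2 * Re (u * cnj a)"
    by (simp add: radius cmod_power2) (simp add: power2_eq_square algebra_simps)
  then have u: "0 < (cmod u)\<^sup>2" by (cases "u = 0") auto
  have "(cmod (a * z - u))\<^sup>2 = (cmod (a * z))\<^sup>2 + (cmod u)\<^sup>2 - 2 * Re (a * z * cnj u)"
    by (simp add: cmod_power2) (simp add: power2_eq_square algebra_simps)
  also have "Re (a * z * cnj u) = Re (u * cnj a) + Re a * (cmod u)\<^sup>2"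
    by (simp add: u_def cmod_power2) (simp add: power2_eq_square algebra_simps)
  also have "(cmod (a * z))\<^sup>2 + (cmod u)\<^sup>2 - 2 * (Re (u * cnj a) + Re a * (cmod u)\<^sup>2) < (cmod (a * z))\<^sup>2"
  proof -
    have "(cmod u)\<^sup>2 \<le> Re a * (cmod u)\<^sup>2" using Re_a u by simp
    then show ?thesis using ext by argo
  qed
  finally have "cmod (a * z - u) < cmod (a * z)"
    by (rule power2_less_imp_less) simp
  moreover have "1 / z - b = (a * z - u) / z"
    using z by (simp add: b u_def field_simps)
  ultimately show ?thesis
    using z by (simp add: norm_divide norm_mult radius divide_simps mult.commute)
qed

lemma inj_on_joukowski_exterior: "inj_on joukowski exterior"
  using inverse_exterior unfolding inj_on_def
  by (auto simp: joukowski_eq_iff exterior_nonzero) (auto simp: exterior_def dest: less_asym)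

lemma K_cases:
  assumes "w \<in> K"
  obtains z where "z \<noteq> 0" "w = joukowski z" "cmod (z - b) \<le> R" "cmod (1 / z - b) \<le> R"
proof -
  obtain z where z: "z \<noteq> 0" "joukowski z = w" by (rule joukowski_surj)
  have "z \<notin> exterior" "1 / z \<notin> exterior"
    using assms z joukowski_inverse[of z] unfolding K_def by (metis ComplD imageI)+
  with that z show ?thesis by (auto simp: exterior_def)
qed

lemma closed_K: "closed K"
proof -
  have "open exterior"
    unfolding exterior_def by (intro open_Collect_less continuous_intros)
  moreover have "joukowski holomorphic_on exterior"
    unfolding joukowski_def by (intro holomorphic_intros) (auto simp: exterior_nonzero)
  ultimately have "open (joukowski ` exterior)"
    using inj_on_joukowski_exterior by (intro open_mapping_thm3)
  then show ?thesis by (simp add: K_def closed_def)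
qed

lemma bounded_K: "bounded K"
proof (intro boundedI)
  fix w assume "w \<in> K"
  then obtain z where z: "z \<noteq> 0" "w = joukowski z" "cmod (z - b) \<le> R" "cmod (1 / z - b) \<le> R"
    by (rule K_cases)
  have "cmod z \<le> R + cmod b" "cmod (1 / z) \<le> R + cmod b"
    using z norm_triangle_ineq[of "z - b" b] norm_triangle_ineq[of "1 / z - b" b] by auto
  then show "cmod w \<le> R + cmod b"
    using norm_triangle_ineq[of z "1 / z"] by (simp add: z joukowski_def norm_divide)
qed

definition boundary :: "real \<Rightarrow> complex" where
  "boundary t = joukowski (b + a * cis (2 * pi * t))"

lemma circle_nonzero: "b + a * cis s \<noteq> 0"
proof
  assume "b + a * cis s = 0"
  then have "cmod b = cmod (- (a * cis s))" by (metis add_eq_0_iff2)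
  then show False using norm_b by (simp add: norm_mult radius)
qed

text \<open>
By \<open>norm_joukowski_diff\<close> the integrand splits into three logarithms of distances from points of the
circle to \<open>z\<close>, \<open>1/z\<close> and \<open>0\<close>; the last point lies inside the circle and contributes \<open>- ln R\<close>.
\<close>

lemma boundary_potential:
  assumes "z \<noteq> 0"
  shows "has_bochner_integral unit_uniform (\<lambda>t. ln (cmod (joukowski z - boundary t)))
     (ln (max R (cmod (z - b))) + ln (max R (cmod (1 / z - b))) - ln 2 - ln R)"
proof -
  define L where "L A t = ln (cmod (A - a * cis (2 * pi * t)))" for A t
  have L: "has_bochner_integral unit_uniform (L A) (ln (max R (cmod A)))" for A
    using circle_log_mean[of A a] a_nonzero by (simp add: L_def[abs_def] radius max.commute)
  have "has_bochner_integral unit_uniform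
      (\<lambda>t. L (z - b) t + L (1 / z - b) t - ln 2 - L (- b) t)
      (ln (max R (cmod (z - b))) + ln (max R (cmod (1 / z - b))) - ln 2 - ln (max R (cmod (- b))))"
    by (intro has_bochner_integral_add has_bochner_integral_diff L)
      (simp add: has_bochner_integral_iff unit.prob_space)
  moreover have "AE t in unit_uniform. L (z - b) t + L (1 / z - b) t - ln 2 - L (- b) t
      = ln (cmod (joukowski z - boundary t))"
    using AE_circle_neq[of "(z - b) / a"] AE_circle_neq[of "(1 / z - b) / a"]
  proof eventually_elim
    case (elim t)
    let ?w = "b + a * cis (2 * pi * t)"
    have ne: "z - ?w \<noteq> 0" "1 / z - ?w \<noteq> 0" "?w \<noteq> 0"
      using elim a_nonzero circle_nonzero by (auto simp: field_simps)
    have "cmod (joukowski z - boundary t) = cmod (z - ?w) * cmod (1 / z - ?w) / (2 * cmod ?w)"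
      unfolding boundary_def by (rule norm_joukowski_diff[OF assms circle_nonzero])
    also have "ln \<dots> = ln (cmod (z - ?w)) + ln (cmod (1 / z - ?w)) - ln 2 - ln (cmod ?w)"
      using ne by (simp add: ln_div ln_mult_pos)
    moreover have "cmod (- b - a * cis (2 * pi * t)) = cmod ?w"
      by (subst norm_minus_cancel[symmetric]) simp
    ultimately show ?case by (simp add: L_def algebra_simps)
  qed
  moreover have "(\<lambda>t. ln (cmod (joukowski z - boundary t))) \<in> borel_measurable unit_uniform"
    unfolding boundary_def joukowski_def cis_conv_exp by (intro measurable_unit_uniform) measurable
  moreover have "L A \<in> borel_measurable unit_uniform" for A
    using L[of A] by (auto simp: has_bochner_integral_iff)
  moreover have "max R (cmod (- b)) = R" using norm_b by simp
  ultimately show ?thesis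
    by (subst (asm) has_bochner_integral_cong_AE) auto
qed

lemma continuous_boundary: "continuous_on S boundary"
  unfolding boundary_def joukowski_def
  using circle_nonzero by (intro continuous_intros) auto

lemma boundary_in_K: "boundary t \<in> K"
proof -
  let ?w = "b + a * cis (2 * pi * t)"
  have w: "cmod (?w - b) = R" by (simp add: norm_mult radius)
  have False if "z \<in> exterior" "joukowski z = joukowski ?w" for z
  proof -
    have "?w = z \<or> ?w = 1 / z"
      using that joukowski_eq_iff[OF exterior_nonzero[OF that(1)] circle_nonzero] by simp
    then have "cmod (z - b) = R \<or> cmod (1 / z - b) = R"
      using w by metis
    then show False
      using that(1) inverse_exterior[OF that(1)] by (simp add: exterior_def)
  qed
  then show ?thesis
    unfolding boundary_def K_def by force
qed

section \<open>The skeleton curve\<close>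

text \<open>
With \<open>s = sin (\<pi> t)\<close>, the points \<open>skeleton t\<close> and \<open>skeleton (1 - t)\<close> are the two roots of
\<open>w\<^sup>2 - 2 b s\<^sup>2 w + b\<^sup>2 s\<^sup>2 - (1 - s\<^sup>2) = 0\<close>. For \<open>w = J z\<close>, \<open>X = z - b\<close> and
\<open>Y = 1/z - b\<close> this equation says that \<open>X = v Y\<close> or \<open>Y = v X\<close>, where \<open>v = exp (2 \<pi> i t)\<close>.
\<close>

definition skeleton :: "real \<Rightarrow> complex" where
  "skeleton t = b * of_real ((sin (pi * t))\<^sup>2)
     + of_real (cos (pi * t)) * csqrt (1 - b\<^sup>2 * of_real ((sin (pi * t))\<^sup>2))"

lemma skeleton_reflect:
  "skeleton (1 - t) = b * of_real ((sin (pi * t))\<^sup>2)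
     - of_real (cos (pi * t)) * csqrt (1 - b\<^sup>2 * of_real ((sin (pi * t))\<^sup>2))"
proof -
  have "sin (pi * (1 - t)) = sin (pi * t)" "cos (pi * (1 - t)) = - cos (pi * t)"
    using sin_diff[of pi "pi * t"] cos_diff[of pi "pi * t"] by (simp_all add: right_diff_distrib)
  then show ?thesis by (simp add: skeleton_def)
qed

text \<open>
Both sides equal \<open>X\<^sup>2 - 2 cos (2 \<pi> t) X Y + Y\<^sup>2 = (X - Y)\<^sup>2 + 4 s\<^sup>2 X Y\<close>, where \<open>s = sin (\<pi> t)\<close>. The right-hand
side is a product of two factors to which \<open>circle_log_mean\<close> applies.
\<close>

lemma skeleton_factor:
  assumes "z \<noteq> 0"
  defines "X \<equiv> z - b" and "Y \<equiv> 1 / z - b"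
  shows "4 * (joukowski z - skeleton t) * (joukowski z - skeleton (1 - t))
    = (X - Y * cis (2 * pi * t)) * (X - Y * cnj (cis (2 * pi * t)))"
proof -
  define y s c q v where "y = 1 / z" and "s = complex_of_real (sin (pi * t))"
    and "c = complex_of_real (cos (pi * t))" and "q = csqrt (1 - b\<^sup>2 * s\<^sup>2)"
    and "v = cis (2 * pi * t)"
  have zy: "z * y = 1" using assms(1) by (simp add: y_def)
  have q: "q\<^sup>2 = 1 - b\<^sup>2 * s\<^sup>2" by (simp add: q_def)
  have c: "c\<^sup>2 = 1 - s\<^sup>2"
    unfolding c_def s_def using sin_cos_squared_add2[of "pi * t"]
    by (simp add: cos_squared_eq flip: of_real_power)
  have vv: "v * cnj v = 1" by (simp add: v_def complex_norm_square[symmetric] flip: complex_norm_square)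
  have "v + cnj v = of_real (2 * cos (2 * (pi * t)))"
    by (simp add: v_def complex_eq_iff mult.assoc)
  also have "\<dots> = 2 - 4 * s\<^sup>2"
    by (simp only: cos_double_sin) (simp add: s_def algebra_simps)
  finally have vs: "v + cnj v = 2 - 4 * s\<^sup>2" .
  have "4 * ((z + y) / 2 - (b * s\<^sup>2 + c * q)) * ((z + y) / 2 - (b * s\<^sup>2 - c * q))
      = (z + y)\<^sup>2 - 4 * b * s\<^sup>2 * (z + y) + 4 * b\<^sup>2 * s\<^sup>2 * s\<^sup>2 - 4 * c\<^sup>2 * q\<^sup>2"
    by (simp add: power2_eq_square field_simps)
  also have "\<dots> = (z - b)\<^sup>2 - (v + cnj v) * ((z - b) * (y - b)) + (v * cnj v) * (y - b)\<^sup>2"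
    unfolding c q vv vs using zy by algebra
  also have "\<dots> = (z - b - (y - b) * v) * (z - b - (y - b) * cnj v)"
    by (simp add: power2_eq_square algebra_simps)
  finally show ?thesis
    unfolding skeleton_reflect skeleton_def[of t] X_def Y_def joukowski_def
    by (simp add: y_def s_def c_def q_def v_def)
qed

lemma norm_skeleton_factor:
  assumes "z \<noteq> 0"
  shows "4 * (cmod (joukowski z - skeleton t) * cmod (joukowski z - skeleton (1 - t)))
    = cmod (z - b - (1 / z - b) * cis (2 * pi * t))
      * cmod (cnj (z - b) - cnj (1 / z - b) * cis (2 * pi * t))"
proof -
  have "cmod (z - b - (1 / z - b) * cnj (cis (2 * pi * t)))
      = cmod (cnj (z - b - (1 / z - b) * cnj (cis (2 * pi * t))))"
    by (simp only: complex_mod_cnj)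
  also have "\<dots> = cmod (cnj (z - b) - cnj (1 / z - b) * cis (2 * pi * t))"
    by simp
  finally show ?thesis
    using arg_cong[OF skeleton_factor[OF assms, of t], of cmod] by (simp only: norm_mult) simp
qed

lemma joukowski_not_skeleton:
  assumes "z \<noteq> 0" "cmod (z - b) \<noteq> cmod (1 / z - b)"
  shows "joukowski z \<noteq> skeleton t"
proof
  assume "joukowski z = skeleton t"
  with skeleton_factor[OF assms(1), of t]
  have "z - b = (1 / z - b) * cis (2 * pi * t) \<or> z - b = (1 / z - b) * cnj (cis (2 * pi * t))"
    by auto
  then have "cmod (z - b) = cmod (1 / z - b)"
    by (metis complex_mod_cnj mult.right_neutral norm_cis norm_mult)
  with assms(2) show False by contradiction
qed

lemma skeleton_in_K: "skeleton t \<in> K"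
proof (rule ccontr)
  assume "skeleton t \<notin> K"
  then obtain z where z: "z \<in> exterior" "joukowski z = skeleton t"
    unfolding K_def by auto
  have "cmod (z - b) \<noteq> cmod (1 / z - b)"
    using z(1) inverse_exterior[OF z(1)] by (auto simp: exterior_def)
  from joukowski_not_skeleton[OF exterior_nonzero[OF z(1)] this] z(2) show False by blast
qed

end

text \<open>
The bound on \<open>Re a = R cos \<theta>\<close> gives \<open>-1/2 \<le> Re b < 0\<close>, so \<open>b\<^sup>2 s\<^sup>2\<close> with \<open>s\<^sup>2 \<le> 1\<close> is never a real number
\<open>\<ge> 1\<close>.
\<close>

locale thin_airfoil = airfoil +
  assumes Re_a_le: "Re a \<le> 3 / 2"
begin

lemma discriminant_not_nonpos:
  assumes "s\<^sup>2 \<le> 1"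
  shows "1 - b\<^sup>2 * of_real (s\<^sup>2) \<notin> \<real>\<^sub>\<le>\<^sub>0"
proof
  have "b = 1 - a" using center by (simp add: algebra_simps)
  then have Re_b: "Re b < 0" "\<bar>Re b\<bar> \<le> 1 / 2" using Re_a Re_a_le by auto
  assume "1 - b\<^sup>2 * of_real (s\<^sup>2) \<in> \<real>\<^sub>\<le>\<^sub>0"
  then have re: "1 \<le> ((Re b)\<^sup>2 - (Im b)\<^sup>2) * s\<^sup>2" and im: "Re b * Im b * s\<^sup>2 = 0"
    by (auto simp: complex_nonpos_Reals_iff Re_power2 Im_power2 simp flip: of_real_power)
  then have "Im b = 0" using Re_b by auto
  moreover have "(Re b)\<^sup>2 \<le> (1 / 2)\<^sup>2"
    using Re_b by (subst abs_le_square_iff[symmetric]) auto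
  ultimately have "((Re b)\<^sup>2 - (Im b)\<^sup>2) * s\<^sup>2 \<le> (1 / 2)\<^sup>2 * 1"
    using assms by (intro mult_mono) auto
  with re show False by (simp add: power2_eq_square)
qed

lemma sin_squared_le_1: "(sin (x::real))\<^sup>2 \<le> 1"
  using abs_square_le_1[of "sin x"] by simp

lemma continuous_skeleton: "continuous_on S skeleton"
proof -
  have "continuous_on S (\<lambda>t. csqrt (1 - b\<^sup>2 * of_real ((sin (pi * t))\<^sup>2)))"
    using discriminant_not_nonpos sin_squared_le_1
    by (intro continuous_on_compose2[OF continuous_on_csqrt]) (auto intro!: continuous_intros simp del: of_real_power)
  then show ?thesis unfolding skeleton_def by (intro continuous_intros)
qed

text \<open>
The quadratic equation satisfied by \<open>w = skeleton t\<close> is linear in \<open>s\<^sup>2\<close>, so \<open>w\<close> determines \<open>s\<^sup>2\<close>; then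
\<open>w\<close> also determines \<open>cos (\<pi> t)\<close> because the square root does not vanish.
\<close>

lemma inj_on_skeleton: "inj_on skeleton {0..1}"
proof
  fix t t' assume t: "t \<in> {0..1}" "t' \<in> {0..1}" and eq: "skeleton t = skeleton t'"
  define w where "w = skeleton t"
  define S where "S t = complex_of_real ((sin (pi * t))\<^sup>2)" for t
  have quad: "w\<^sup>2 - 1 = S t * (2 * b * w - b\<^sup>2 - 1)" if "w = skeleton t" for t
  proof -
    let ?c = "complex_of_real (cos (pi * t))" and ?q = "csqrt (1 - b\<^sup>2 * S t)"
    have "w - b * S t = ?c * ?q" using that by (simp add: skeleton_def S_def)
    then have "(w - b * S t)\<^sup>2 = ?c\<^sup>2 * ?q\<^sup>2" by (simp add: power_mult_distrib)
    also have "?c\<^sup>2 = 1 - S t" by (simp add: S_def cos_squared_eq flip: of_real_power)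
    finally show ?thesis unfolding power2_csqrt by algebra
  qed
  have "2 * b * w - b\<^sup>2 - 1 \<noteq> 0"
  proof
    assume 0: "2 * b * w - b\<^sup>2 - 1 = 0"
    with quad[OF w_def] have "w\<^sup>2 = 1" by simp
    with 0 have "(b - w)\<^sup>2 = 0" by algebra
    then have "b = w" by simp
    with \<open>w\<^sup>2 = 1\<close> have "b\<^sup>2 = 1" by simp
    then show False using discriminant_not_nonpos[of 1] by simp
  qed
  moreover have "S t * (2 * b * w - b\<^sup>2 - 1) = S t' * (2 * b * w - b\<^sup>2 - 1)"
    using quad[of t] quad[of t'] eq by (simp add: w_def)
  ultimately have S: "S t = S t'" by simp
  then have "(cos (pi * t))\<^sup>2 = (cos (pi * t'))\<^sup>2"
    unfolding S_def of_real_eq_iff by (simp add: cos_squared_eq)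
  moreover have "complex_of_real (cos (pi * t)) * csqrt (1 - b\<^sup>2 * S t) = of_real (cos (pi * t')) * csqrt (1 - b\<^sup>2 * S t)"
    using eq S unfolding skeleton_def S_def[symmetric] by simp
  moreover have "csqrt (1 - b\<^sup>2 * S t) \<noteq> 0"
    using discriminant_not_nonpos[OF sin_squared_le_1, of "pi * t"] unfolding S_def by auto
  ultimately have "cos (pi * t) = cos (pi * t')" by (simp only: mult_cancel_right of_real_eq_iff) simp
  then have "pi * t = pi * t'"
    using t by (intro cos_inj_pi[of "pi * t" "pi * t'"]) (auto simp del: mult_cancel_left)
  then show "t = t'" by simp
qed

lemma arc_skeleton: "arc skeleton"
  using continuous_skeleton inj_on_skeleton by (simp add: arc_def path_def)

text \<open>
Averaging the integrand with its reflection \<open>t \<mapsto> 1 - t\<close> makes \<open>skeleton_factor\<close> applicable.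
\<close>

lemma skeleton_potential:
  assumes "z \<noteq> 0" "cmod (z - b) \<noteq> cmod (1 / z - b)"
  shows "has_bochner_integral unit_uniform (\<lambda>t. ln (cmod (joukowski z - skeleton t)))
     (ln (max (cmod (z - b)) (cmod (1 / z - b))) - ln 2)"
proof -
  define X Y where "X = z - b" and "Y = 1 / z - b"
  define g where "g t = ln (cmod (joukowski z - skeleton t))" for t
  have ne: "joukowski z - skeleton t \<noteq> 0" for t
    using joukowski_not_skeleton[OF assms] by simp
  have XY: "X \<noteq> 0 \<or> Y \<noteq> 0" using assms(2) by (auto simp: X_def Y_def)
  have cont: "continuous_on {0..1} g"
    unfolding g_def using ne by (intro continuous_intros continuous_skeleton) auto
  then obtain I where I: "(g has_integral I) {0..1}"
    using integrable_continuous_real by blast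
  have "((\<lambda>t. g (1 - t)) has_integral I) {0..1}"
    using has_integral_affinity01[where m="-1" and c=1, of g I] I by (simp add: o_def)
  moreover have "continuous_on {0..1} (\<lambda>t. g (1 - t))"
    by (intro continuous_on_compose2[OF cont] continuous_intros) auto
  ultimately have sum: "has_bochner_integral unit_uniform (\<lambda>t. g t + g (1 - t)) (I + I)"
    by (intro has_bochner_integral_add has_bochner_integral_unit_uniform cont I)
  have sum_eq: "g t + g (1 - t) = ln (cmod (X - Y * cis (2 * pi * t)))
      + ln (cmod (cnj X - cnj Y * cis (2 * pi * t))) - ln 4" for t
  proof -
    have "0 < cmod (joukowski z - skeleton t)" "0 < cmod (joukowski z - skeleton (1 - t))"
      using ne by auto
    then have "g t + g (1 - t) + ln 4
        = ln (4 * (cmod (joukowski z - skeleton t) * cmod (joukowski z - skeleton (1 - t))))"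
      by (simp add: g_def ln_mult_pos)
    also have "4 * (cmod (joukowski z - skeleton t) * cmod (joukowski z - skeleton (1 - t)))
        = cmod (X - Y * cis (2 * pi * t)) * cmod (cnj X - cnj Y * cis (2 * pi * t))"
      unfolding X_def Y_def by (rule norm_skeleton_factor[OF assms(1)])
    also have "ln \<dots> = ln (cmod (X - Y * cis (2 * pi * t)))
      + ln (cmod (cnj X - cnj Y * cis (2 * pi * t)))"
    proof (intro ln_mult_pos)
      have "cmod X \<noteq> cmod Y"
        using assms(2) by (simp add: X_def Y_def)
      then have "cmod X \<noteq> cmod (Y * cis s)" "cmod (cnj X) \<noteq> cmod (cnj Y * cis s)" for s
        by (simp_all only: norm_mult norm_cis complex_mod_cnj mult_1_right not_False_eq_True)
      from this[of "2 * pi * t"] have "X \<noteq> Y * cis (2 * pi * t)" "cnj X \<noteq> cnj Y * cis (2 * pi * t)"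
        by (blast intro: arg_cong[where f=cmod])+
      then show "0 < cmod (X - Y * cis (2 * pi * t))" "0 < cmod (cnj X - cnj Y * cis (2 * pi * t))"
        by simp_all
    qed
    finally show ?thesis by simp
  qed
  have "has_bochner_integral unit_uniform (\<lambda>t. ln (cmod (X - Y * cis (2 * pi * t)))
      + ln (cmod (cnj X - cnj Y * cis (2 * pi * t))) - ln 4)
      (ln (max (cmod X) (cmod Y)) + ln (max (cmod (cnj X)) (cmod (cnj Y))) - ln 4)"
    using XY by (intro has_bochner_integral_add has_bochner_integral_diff circle_log_mean)
      (auto simp: has_bochner_integral_iff unit.prob_space)
  from has_bochner_integral_eq[OF sum[unfolded sum_eq] this]
  have "I + I = ln (max (cmod X) (cmod Y)) + ln (max (cmod X) (cmod Y)) - ln 4"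
    by (simp only: complex_mod_cnj)
  moreover have "ln 4 = 2 * ln (2::real)" using ln_realpow[of 2 2] by simp
  ultimately have "I = ln (max (cmod X) (cmod Y)) - ln 2" by simp
  with has_bochner_integral_unit_uniform[OF cont I] show ?thesis
    by (simp add: g_def[abs_def] X_def Y_def)
qed

end

section \<open>The two potentials and the skeleton\<close>

context airfoil
begin

lemma measurable_boundary: "boundary \<in> borel_measurable unit_uniform"
  by (intro measurable_unit_uniform_continuous continuous_boundary)

lemma AE_boundary_neq:
  assumes "z \<noteq> 0"
  shows "AE t in unit_uniform. boundary t \<noteq> joukowski z"
  using AE_circle_neq[of "(z - b) / a"] AE_circle_neq[of "(1 / z - b) / a"]
proof eventually_elim
  case (elim t)
  then have "z \<noteq> b + a * cis (2 * pi * t)" "1 / z \<noteq> b + a * cis (2 * pi * t)"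
    using a_nonzero by auto
  then show ?case
    unfolding boundary_def using joukowski_eq_iff[OF assms circle_nonzero, of "2 * pi * t"] by metis
qed

lemma log_potential_boundary:
  assumes "z \<noteq> 0"
  shows "log_potential (distr unit_uniform borel boundary) (joukowski z)
    = ereal (ln 2 + ln R - ln (max R (cmod (z - b))) - ln (max R (cmod (1 / z - b))))"
  using log_potential_distr_unit[OF measurable_boundary boundary_potential[OF assms] AE_boundary_neq[OF assms]]
  by (simp add: algebra_simps)

lemma equilibrium_measure_K:
  "equilibrium_measure K = distr unit_uniform borel boundary"
proof (rule equilibrium_measure_eqI[OF closed_K bounded_K])
  show "distr unit_uniform borel boundary \<in> borel_prob_measures_on K"
    unfolding borel_prob_measures_on_def
    using closed_support_distr_unit[OF measurable_boundary _ closed_K] boundary_in_K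
      unit.prob_space_distr[OF measurable_boundary] by (simp add: image_subset_iff)
  show "log_potential (distr unit_uniform borel boundary) w = ereal (ln 2 - ln R)" if "w \<in> K" for w
  proof -
    from that obtain z where "z \<noteq> 0" "w = joukowski z" "cmod (z - b) \<le> R" "cmod (1 / z - b) \<le> R"
      by (rule K_cases)
    then show ?thesis by (simp add: log_potential_boundary max_absorb1)
  qed
qed

end

context thin_airfoil
begin

lemma log_potential_skeleton:
  assumes "z \<noteq> 0" "cmod (z - b) \<noteq> cmod (1 / z - b)"
  shows "log_potential (distr unit_uniform borel skeleton) (joukowski z)
    = ereal (ln 2 - ln (max (cmod (z - b)) (cmod (1 / z - b))))"
proof -
  have "AE t in unit_uniform. skeleton t \<noteq> joukowski z"
    using joukowski_not_skeleton[OF assms] by (intro AE_I2) metis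
  from log_potential_distr_unit[OF measurable_unit_uniform_continuous[OF continuous_skeleton]
      skeleton_potential[OF assms] this]
  show ?thesis by simp
qed

text \<open>
The closed support is contained in the arc, whose complement is connected and dense, and any set
between a connected set and its closure is connected.
\<close>

lemma skeleton_is_electrostatic:
  "is_electrostatic_skeleton K (distr unit_uniform borel skeleton)"
proof -
  let ?M = "distr unit_uniform borel skeleton"
  have meas: "skeleton \<in> borel_measurable unit_uniform"
    by (intro measurable_unit_uniform_continuous continuous_skeleton)
  have supp: "closed_support ?M \<subseteq> path_image skeleton"
    using closed_arc_image[OF arc_skeleton] by (intro closed_support_distr_unit[OF meas]) (auto simp: path_image_def)
  have arc: "interior (path_image skeleton) = {}"
    by (intro interior_arc_image arc_skeleton) simp
  have int: "interior (closed_support ?M) = {}"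
    using interior_mono[OF supp] arc by simp
  have "connected (- closed_support ?M)"
  proof (rule connected_intermediate_closure)
    show "connected (- path_image skeleton)"
      by (intro connected_arc_complement arc_skeleton) simp
    show "- path_image skeleton \<subseteq> - closed_support ?M" using supp by auto
    show "- closed_support ?M \<subseteq> closure (- path_image skeleton)"
      by (simp add: closure_complement arc)
  qed
  moreover have "log_potential ?M w = log_potential (equilibrium_measure K) w" if w: "w \<in> - K" for w
  proof -
    obtain z where z: "z \<in> exterior" "w = joukowski z" using w by (auto simp: K_def)
    have "R < cmod (z - b)" "cmod (1 / z - b) < R"
      using z(1) inverse_exterior[OF z(1)] by (auto simp: exterior_def)
    then show ?thesis
      using exterior_nonzero[OF z(1)]
      by (simp add: z(2) equilibrium_measure_K log_potential_boundary log_potential_skeleton)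
  qed
  moreover have "closed_support ?M \<subseteq> K"
    using closed_support_distr_unit[OF meas _ closed_K] skeleton_in_K by auto
  moreover have "finite_measure ?M"
    using unit.prob_space_distr[OF meas] by (rule prob_space.finite_measure)
  ultimately show ?thesis
    using int by (simp add: is_electrostatic_skeleton_def)
qed

end

theorem mainTheorem5:
  fixes R \<theta> :: real
  assumes "R > 1"
    and "- pi / 2 < \<theta>" and "\<theta> < pi / 2"
    and "1 < R * cos \<theta>" and "R * cos \<theta> \<le> 3 / 2"
  shows "admits_electrostatic_skeleton (joukowski_airfoil R \<theta>)"
proof -
  define a where "a = of_real R * exp (\<i> * of_real \<theta>)"
  have a: "Re a = R * cos \<theta>" "cmod a = R"
    using assms(1) by (simp_all add: a_def norm_mult Re_exp)
  interpret thin_airfoil a "1 - a" R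
    by unfold_locales (use assms a in auto)
  have "airfoil_map R \<theta> ` {z. 1 < cmod z} = joukowski ` exterior"
  proof -
    have "(\<lambda>z. a * z + (1 - a)) ` {z. 1 < cmod z} = exterior"
    proof (intro equalityI subsetI)
      fix w assume w: "w \<in> exterior"
      have "w = a * ((w - (1 - a)) / a) + (1 - a)" using a_nonzero by simp
      moreover have "1 < cmod ((w - (1 - a)) / a)"
        using w a(2) R_pos by (simp add: norm_divide exterior_def)
      ultimately show "w \<in> (\<lambda>z. a * z + (1 - a)) ` {z. 1 < cmod z}" by blast
    qed (use a R_pos in \<open>auto simp: exterior_def norm_mult\<close>)
    then show ?thesis
      unfolding airfoil_map_def a_def[symmetric] Let_def by (metis image_image)
  qed
  then have "joukowski_airfoil R \<theta> = K"
    by (simp add: joukowski_airfoil_def K_def)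
  then show ?thesis
    using skeleton_is_electrostatic by (auto simp: admits_electrostatic_skeleton_def)
qed

end
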